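(* Let $n\ge5$ and $s$ be integers with $1<s<n/2$, let $q=\lfloor n/s\rfloor$ and $r=n-qs$. For an integer $x$ let $\epsilon(x)=1$ if $x$ is odd and $0$ if $x$ is even, and let $\kappa(a)=a+\frac{\epsilon(s)+\epsilon(q)}{2}$. Then: (a) if $2\le s\le \sqrt{n-r+(\kappa(-2))^2}+\kappa(-2)$, then $$\frac{n^2-\epsilon(n)}{8(s+1)}\le \overrightarrow{w}(C_n(1,s))\le \frac{s+2}{24}\Big(6q^2+3q(s+4)+s(4s+10)+\epsilon(q)(2q+3s+3)\Big);$$ (b) if $\sqrt{n-r+(\kappa(-1))^2}+\kappa(-1)\le s\le \sqrt{n-r+(\kappa(0))^2}+\kappa(0)$, then $$\frac{n^2-\epsilon(n)}{8(s+1)}\le \overrightarrow{w}(C_n(1,s))\le \frac{q(q+2)(5q+2)}{24}+\frac{s(s+2)(2s+5)}{6}+\epsilon(q)\frac{5q^2+13q+7}{8};$$ (c) if $\sqrt{n-r+(\kappa(1))^2}+\kappa(1)\le s<n/2$, then $$\max\left\{\frac{n^2-\epsilon(n)}{8(s+1)},\frac{(n-1)(\sqrt{2n}-7)^3}{24n}\right\}\le \overrightarrow{w}(C_n(1,s))\le \frac{q(q+2)(q+10)}{24}+\frac{s(s+2)(q+1)}{2}+\epsilon(q)\frac{(q+5)^2+4(s+1)^2}{8}.$$ Moreover, in each of (a), (b), (c) the same lower and upper bounds hold with $\overrightarrow{w}(C_n(1,s))$ replaced by $w(C_n(1,s))/2$.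
   Context: The circulant graph $C_n(1,s)$ has vertex set $\mathbb{Z}_n$, with $i,j$ adjacent iff $i-j\in\{\pm1,\pm s\}$ mod $n$. An arc is an ordered pair of adjacent vertices. An all-to-all routing $R$ of a graph $G$ is a set of oriented paths with exactly one path from $x$ to $y$ for each ordered pair of distinct vertices. A colouring of the paths of $R$ is edge-conflict-free if any two paths sharing an edge (regardless of orientation) get distinct colours, and arc-conflict-free if any two paths traversing a common arc in the same direction get distinct colours. $w(G,R)$ (resp. $\overrightarrow{w}(G,R)$) is the minimum number of colours in an edge-conflict-free (resp. arc-conflict-free) colouring of $R$; the undirected optical index is $w(G)=\min_R w(G,R)$ and the directed optical index is $\overrightarrow{w}(G)=\min_R\overrightarrow{w}(G,R)$, minima over all all-to-all routings $R$. *)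

theory Defs
  imports
    Complex_Main
    "HOL-Number_Theory.Cong"
    "Graph_Theory.Pair_Digraph"
    "Graph_Theory.Vertex_Walk"
begin

text \<open>
  Undirected simple graphs are represented as symmetric loop-free pair digraphs, so that
  \<open>parcs G\<close> is the set of arcs (ordered pairs of adjacent vertices). An oriented path is its
  list of pairwise distinct vertices (\<^const>\<open>vpath\<close>).
\<close>

text \<open>The vertex set \<open>\<int>\<^sub>n\<close> is represented by the residues \<open>0, \<dots>, n - 1\<close>.\<close>

definition circulant :: "int \<Rightarrow> int \<Rightarrow> int pair_pre_digraph" where
  "circulant n s =
     \<lparr> pverts = {0..<n},
       parcs = {(i, j). i \<in> {0..<n} \<and> j \<in> {0..<n} \<and>
                  (\<exists>d \<in> {1, -1, s, -s}. [i - j = d] (mod n))} \<rparr>"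

text \<open>The condition \<open>hd p \<noteq> last p\<close> excludes trivial one-vertex paths.\<close>

definition all_to_all_routing :: "'a pair_pre_digraph \<Rightarrow> 'a vwalk set \<Rightarrow> bool" where
  "all_to_all_routing G R \<longleftrightarrow>
     (\<forall>p \<in> R. vpath p (with_proj G) \<and> hd p \<noteq> last p) \<and>
     (\<forall>x \<in> pverts G. \<forall>y \<in> pverts G. x \<noteq> y \<longrightarrow> (\<exists>!p. p \<in> R \<and> hd p = x \<and> last p = y))"

definition vwalk_edges :: "'a vwalk \<Rightarrow> 'a set set" where
  "vwalk_edges p = (\<lambda>(u, v). {u, v}) ` set (vwalk_arcs p)"

definition edge_conflict_free :: "'a vwalk set \<Rightarrow> ('a vwalk \<Rightarrow> nat) \<Rightarrow> bool" where
  "edge_conflict_free R c \<longleftrightarrow>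
     (\<forall>p \<in> R. \<forall>p' \<in> R. p \<noteq> p' \<and> vwalk_edges p \<inter> vwalk_edges p' \<noteq> {} \<longrightarrow> c p \<noteq> c p')"

definition arc_conflict_free :: "'a vwalk set \<Rightarrow> ('a vwalk \<Rightarrow> nat) \<Rightarrow> bool" where
  "arc_conflict_free R c \<longleftrightarrow>
     (\<forall>p \<in> R. \<forall>p' \<in> R. p \<noteq> p' \<and> set (vwalk_arcs p) \<inter> set (vwalk_arcs p') \<noteq> {} \<longrightarrow> c p \<noteq> c p')"

text \<open>
  The minimum numbers of colours \<open>w(G, R)\<close> and, for arcs, its directed analogue. They depend on
  the routing only, and are meaningful for finite \<open>R\<close> (\<^const>\<open>card\<close> is 0 on infinite sets);
  every routing of a finite graph is finite.
\<close>

definition edge_colour_number :: "'a vwalk set \<Rightarrow> nat" where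
  "edge_colour_number R = (LEAST k. \<exists>c. edge_conflict_free R c \<and> card (c ` R) = k)"

definition arc_colour_number :: "'a vwalk set \<Rightarrow> nat" where
  "arc_colour_number R = (LEAST k. \<exists>c. arc_conflict_free R c \<and> card (c ` R) = k)"

text \<open>These minima are over a nonempty set precisely when \<open>G\<close> is connected.\<close>

definition undirected_optical_index :: "'a pair_pre_digraph \<Rightarrow> nat" where
  "undirected_optical_index G =
     (LEAST k. \<exists>R. all_to_all_routing G R \<and> edge_colour_number R = k)"

definition directed_optical_index :: "'a pair_pre_digraph \<Rightarrow> nat" where
  "directed_optical_index G =
     (LEAST k. \<exists>R. all_to_all_routing G R \<and> arc_colour_number R = k)"

definition odd_ind :: "int \<Rightarrow> real" where
  "odd_ind x = (if odd x then 1 else 0)"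

definition kappa :: "int \<Rightarrow> int \<Rightarrow> real \<Rightarrow> real" where
  "kappa s q a = a + (odd_ind s + odd_ind q) / 2"

end

theory Submission
  imports Defs
begin

text \<open>
  Upper bounds. Write each difference \<open>d \<le> n / 2\<close> as \<open>d = a + b s\<close> with \<open>\<bar>a\<bar> \<le> s / 2\<close> and route
  \<open>x \<rightarrow> x + d\<close> by \<open>\<bar>a\<bar>\<close> unit steps followed by \<open>b\<close> steps of length \<open>s\<close>. Two such paths with the same \<open>d\<close>
  share an edge only if their starting points differ by \<open>k\<close> with \<open>\<bar>k\<bar> < \<bar>a\<bar>\<close> or by \<open>k s\<close> with
  \<open>\<bar>k\<bar> < b\<close>, and all \<open>n\<close> of them can be coloured with \<open>2 max b (2 \<bar>a\<bar>)\<close> colours. Summing over \<open>d\<close> gives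
  cubic polynomials in \<open>s div 2\<close> and \<open>(q + 1) div 2\<close>, and the square-root conditions of the three
  cases say how these two numbers compare.

  Lower bounds. Every arc carries at most \<open>w\<close> paths (on average over its two orientations). Weighting
  unit arcs by 1 and long arcs by \<open>s\<close>, a path from \<open>x\<close> to \<open>y\<close> weighs at least the cyclic distance of \<open>x\<close>
  and \<open>y\<close>; with all weights 1, at most \<open>2 r\<^sup>2 + 2 r + 1\<close> vertices lie within distance \<open>r\<close>.
\<close>

section \<open>Colouring the paths of one difference class\<close>

lemma div_add_small_cases:
  fixes x k s :: int
  assumes "0 < s" "0 \<le> k" "k < s"
  shows "(x + k) div s = x div s + (if s \<le> x mod s + k then 1 else 0)"
proof -
  have r: "0 \<le> x mod s" "x mod s < s" using assms by auto
  have "x + k = x div s * s + (x mod s + k)" by simp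
  then have "(x + k) div s = x div s + (x mod s + k) div s"
    using assms(1) by (metis add.commute div_mult_self1 less_irrefl)
  moreover have "(x mod s + k) div s = (if s \<le> x mod s + k then 1 else 0)"
  proof (cases "s \<le> x mod s + k")
    case True
    then have "(x mod s + k) div s = 1"
      using r(2) assms by (intro int_div_pos_eq[where r = "x mod s + k - s"]; linarith)
    with True show ?thesis by simp
  qed (use r assms in \<open>auto simp: div_pos_pos_trivial\<close>)
  ultimately show ?thesis by simp
qed

text \<open>The jumps of \<open>x div s\<close> and of the shifted quotient lie half a block apart.
  A window shorter than half a block that crosses a multiple of \<open>s\<close> starts after one
  shifted jump and ends before the next.\<close>

lemma half_shift_carry:
  fixes x k s :: int
  assumes "0 < s" "0 < k" "2 * k < s" "s \<le> x mod s + k"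
  shows "(x + k + (s - s div 2)) div s = (x + (s - s div 2)) div s"
proof -
  define p where "p = x mod s"
  have p: "0 \<le> p" "p < s" "s \<le> p + k" using assms by (auto simp: p_def)
  have x: "x = x div s * s + p" by (simp add: p_def)
  have "(x + k + (s - s div 2)) div s = x div s + 1"
    using x p assms by (intro int_div_pos_eq[where r = "p + k - s div 2"]) (auto simp: algebra_simps)
  moreover have "(x + (s - s div 2)) div s = x div s + 1"
    using x p assms by (intro int_div_pos_eq[where r = "p - s div 2"]) (auto simp: algebra_simps)
  ultimately show ?thesis by simp
qed

text \<open>
  \<open>G\<close> advances by 1 at each step, plus one extra jump \<open>e\<close> resp. \<open>e'\<close> in each half of a block of
  length \<open>s\<close>, chosen so that \<open>s + e + e' \<equiv> 1\<close> modulo \<open>m\<close>. A window of length \<open>a \<le> s / 2\<close> meets at most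
  one jump, so it advances by less than \<open>m\<close>.
\<close>
lemma shear_colouring:
  fixes s a m :: int
  assumes "2 \<le> s" "0 \<le> a" "2 * a \<le> s" "2 * a \<le> m" "0 < m"
  obtains G :: "int \<Rightarrow> int"
    where "\<And>x k. G (x + k * s) mod m = (G x + k) mod m"
      and "\<And>x k. 0 < k \<Longrightarrow> k < a \<Longrightarrow> G (x + k) mod m \<noteq> G x mod m"
proof -
  define E where "E = (1 - s) mod m"
  have E: "0 \<le> E" "E < m" using assms by (auto simp: E_def)
  \<comment> \<open>Since \<open>E < m\<close> and \<open>2 * a \<le> m\<close>, the correction
    \<open>E\<close> is less than \<open>2 * (m - a)\<close> and splits into two jumps of at most
    \<open>m - a\<close>. A shift below \<open>a\<close> together with one such jump stays below
    \<open>m\<close>.\<close>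
  define e where "e = min E (m - a)"
  define e' where "e' = E - e"
  have e: "0 \<le> e" "e \<le> m - a" "0 \<le> e'" "e' \<le> m - a"
    using E assms by (auto simp: e_def e'_def)
  define u where "u = s - s div 2"
  define G where "G x = x + e * ((x + u) div s) + e' * (x div s)" for x
  have shift: "G (x + k * s) mod m = (G x + k) mod m" for x k
  proof -
    have d: "(y + k * s) div s = y div s + k" for y
      using assms by simp
    have "(x + k * s + u) div s = (x + u) div s + k"
      using d[of "x + u"] by (simp add: algebra_simps)
    then have G': "G (x + k * s) = G x + k * (s + E)"
      unfolding G_def d by (simp add: e'_def algebra_simps)
    have "(s + E) mod m = 1 mod m"
      unfolding E_def by (simp add: mod_simps)
    then show ?thesis unfolding G' by (metis mod_add_right_eq mod_mult_right_eq mult.right_neutral)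
  qed
  have window: "G (x + k) mod m \<noteq> G x mod m" if k: "0 < k" "k < a" for x k
  proof -
    have ks: "0 \<le> k" "k < s" "0 < s" using k assms by auto
    have "\<exists>\<delta>. 0 \<le> \<delta> \<and> \<delta> \<le> m - a \<and> G (x + k) = G x + k + \<delta>"
    proof (cases "s \<le> x mod s + k")
      \<comment> \<open>A window that crosses a block boundary picks up \<open>e'\<close> and misses
        the half-block jump; any other window can only meet \<open>e\<close>.\<close>
      case True
      then have "(x + k + u) div s = (x + u) div s"
        unfolding u_def using k assms by (intro half_shift_carry) auto
      moreover have "(x + k) div s = x div s + 1"
        using div_add_small_cases[OF ks(3,1,2)] True by simp
      ultimately have "G (x + k) = G x + k + e'"
        unfolding G_def by (simp add: algebra_simps)
      then show ?thesis using e by blast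
    next
      case False
      then have "(x + k) div s = x div s"
        using div_add_small_cases[OF ks(3,1,2)] by simp
      moreover have "(x + u + k) div s = (x + u) div s + (if s \<le> (x + u) mod s + k then 1 else 0)"
        using div_add_small_cases[OF ks(3,1,2)] .
      ultimately have "G (x + k) = G x + k + (if s \<le> (x + u) mod s + k then e else 0)"
        unfolding G_def by (simp add: algebra_simps)
      then show ?thesis using e by (auto split: if_splits)
    qed
    then obtain \<delta> where \<delta>: "0 \<le> \<delta>" "\<delta> \<le> m - a" "G (x + k) = G x + k + \<delta>" by blast
    show ?thesis
    proof
      assume "G (x + k) mod m = G x mod m"
      then have "m dvd k + \<delta>"
        unfolding \<delta>(3) mod_eq_dvd_iff by (simp add: algebra_simps)
      then show False using \<delta> k by (auto dest: zdvd_imp_le)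
    qed
  qed
  show ?thesis using that[of G] shift window by blast
qed

lemma cong_small_diff_eq:
  fixes x y z n :: int
  assumes "[x = y] (mod n)" "\<bar>x - y\<bar> < n"
  shows "x = y"
  using assms dvd_imp_le_int[of "x - y" n] by (auto simp: cong_iff_dvd_diff)

text \<open>
  Cutting the cycle into two halves with disjoint palettes turns congruences modulo \<open>n\<close> between
  equally coloured points into equalities, at the price of a factor 2.
\<close>
lemma circular_colouring:
  fixes n s a b :: int
  assumes "2 \<le> s" "2 * s < n" "0 \<le> a" "2 * a \<le> s" "0 \<le> b" "2 * ((b - 1) * s) \<le> n" "0 < a \<or> 0 < b"
  obtains col :: "int \<Rightarrow> nat"
    where "\<And>x. int (col x) < 2 * max b (2 * a)"
      and "\<And>x y k. x \<in> {0..<n} \<Longrightarrow> y \<in> {0..<n} \<Longrightarrow> x \<noteq> y \<Longrightarrow> \<bar>k\<bar> < a \<Longrightarrow>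
             [x - y = k] (mod n) \<Longrightarrow> col x \<noteq> col y"
      and "\<And>x y k. x \<in> {0..<n} \<Longrightarrow> y \<in> {0..<n} \<Longrightarrow> x \<noteq> y \<Longrightarrow> \<bar>k\<bar> < b \<Longrightarrow>
             [x - y = k * s] (mod n) \<Longrightarrow> col x \<noteq> col y"
proof -
  define m where "m = max b (2 * a)"
  have m: "0 < m" "b \<le> m" "2 * a \<le> m" using assms by (auto simp: m_def)
  obtain G :: "int \<Rightarrow> int"
    where G1: "\<And>x k. G (x + k * s) mod m = (G x + k) mod m"
      and G2: "\<And>x k. 0 < k \<Longrightarrow> k < a \<Longrightarrow> G (x + k) mod m \<noteq> G x mod m"
    using shear_colouring[of s a m] assms m by blast
  define col where "col x = nat (G x mod m + (if 2 * x < n then 0 else m))" for x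
  have col_lt: "int (col x) < 2 * m" for x
  proof -
    have "0 \<le> G x mod m" "G x mod m < m" using m by auto
    then show ?thesis unfolding col_def by auto
  qed
  have same: "G x mod m = G y mod m \<and> (2 * x < n \<longleftrightarrow> 2 * y < n)" if "col x = col y" for x y
  proof -
    have r: "0 \<le> G z mod m" "G z mod m < m" for z using m by auto
    have "int (col z) = G z mod m + (if 2 * z < n then 0 else m)" for z
      using r[of z] m by (simp add: col_def)
    from this[of x] this[of y] show ?thesis
      using that r(1)[of x] r(2)[of x] r(1)[of y] r(2)[of y]
      by (cases "2 * x < n"; cases "2 * y < n"; simp only: if_True if_False; linarith)
  qed
  have near: "\<bar>x - y\<bar> * 2 < n"
    if "x \<in> {0..<n}" "y \<in> {0..<n}" "2 * x < n \<longleftrightarrow> 2 * y < n" for x y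
    using that by (auto simp: abs_if)
  have c1: "col x \<noteq> col y" if xy: "x \<in> {0..<n}" "y \<in> {0..<n}" "x \<noteq> y" and k: "\<bar>k\<bar> < a"
    and c: "[x - y = k] (mod n)" for x y k
  proof
    assume "col x = col y"
    note sm = same[OF this]
    \<comment> \<open>Two points of the same half differ by less than \<open>n / 2\<close>, and
      \<open>\<bar>k\<bar> < a \<le> s / 2 < n / 4\<close>, so the congruence is an equality of
      integers.\<close>
    have "\<bar>x - y - k\<bar> < n" using near[OF xy(1,2) conjunct2[OF sm]] k assms(2,4)
      by (simp add: abs_if split: if_splits)
    then have eq: "x - y = k" using cong_small_diff_eq[OF c] by simp
    show False
    proof (cases "0 < k")
      case True
      then show False using G2[of k y] k eq sm by (auto simp: algebra_simps)
    next
      case False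
      then show False using G2[of "-k" x] k eq sm xy(3) by (auto simp: algebra_simps)
    qed
  qed
  have c2: "col x \<noteq> col y" if xy: "x \<in> {0..<n}" "y \<in> {0..<n}" "x \<noteq> y" and k: "\<bar>k\<bar> < b"
    and c: "[x - y = k * s] (mod n)" for x y k
  proof
    assume "col x = col y"
    note sm = same[OF this]
    have "\<bar>k * s\<bar> \<le> (b - 1) * s" using k assms by (auto simp: abs_mult intro: mult_right_mono)
    then have "2 * \<bar>k * s\<bar> \<le> n" using assms(6) by linarith
    moreover have "w < n" if "2 * v \<le> n" "u * 2 < n" "w \<le> u + v" for u v w
      using that by linarith
    ultimately have "\<bar>x - y - k * s\<bar> < n"
      using near[OF xy(1,2) conjunct2[OF sm]] abs_triangle_ineq4[of "x - y" "k * s"] by blast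
    then have eq: "x = y + k * s" using cong_small_diff_eq[OF c] by simp
    \<comment> \<open>Along steps of length \<open>s\<close> the colour value advances by exactly 1,
      so equal colours need \<open>m dvd k\<close>, while
      \<open>\<bar>k\<bar> < b \<le> m\<close>.\<close>
    have "(G y + k) mod m = G y mod m" using G1[of y k] sm eq by simp
    then have "m dvd k" by (simp add: mod_eq_dvd_iff)
    then have "k = 0" using dvd_imp_le_int[of k m] k m by auto
    then show False using eq xy(3) by simp
  qed
  show ?thesis using that[of col] col_lt c1 c2 unfolding m_def by blast
qed

section \<open>Walks with one bend\<close>

lemma vwalk_arcs_map_upt:
  "vwalk_arcs (map f [0..<Suc k]) = map (\<lambda>i. (f i, f (Suc i))) [0..<k]"
proof (induction k)
  case (Suc k)
  have "vwalk_arcs (map f [0..<Suc k] @ [f (Suc k)]) =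
      vwalk_arcs (map f [0..<Suc k]) @ [(f k, f (Suc k))]"
    by (subst vwalk_arcs_append) auto
  then show ?case using Suc.IH by simp
qed simp

lemma vwalk_arcs_rev:
  "vwalk_arcs (rev p) = rev (map (\<lambda>(u, v). (v, u)) (vwalk_arcs p))"
proof (induction p rule: vwalk_arcs.induct)
  case (3 x y xs)
  have "vwalk_arcs (rev (y # xs) @ [x]) = vwalk_arcs (rev (y # xs)) @ [(y, x)]"
    by (subst vwalk_arcs_append) (auto simp: last_rev)
  then show ?case using 3 by simp
qed auto

lemma vwalk_edges_rev [simp]: "vwalk_edges (rev p) = vwalk_edges p"
  by (force simp: vwalk_edges_def vwalk_arcs_rev image_image insert_commute)

lemma in_vwalk_arcs_verts: "(u, v) \<in> set (vwalk_arcs p) \<Longrightarrow> u \<in> set p \<and> v \<in> set p"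
  by (induction p rule: vwalk_arcs.induct) auto

lemma distinct_vwalk_arcs: "distinct p \<Longrightarrow> distinct (vwalk_arcs p)"
  by (induction p rule: vwalk_arcs.induct) (auto dest: in_vwalk_arcs_verts)

text \<open>Serves both directions of the estimate: a path shares no arc with its own reversal, and
  no path loads both orientations of an edge.\<close>

lemma distinct_vwalk_arcs_asym:
  "distinct p \<Longrightarrow> (u, v) \<in> set (vwalk_arcs p) \<Longrightarrow> (v, u) \<notin> set (vwalk_arcs p)"
  by (induction p rule: vwalk_arcs.induct) (auto dest: in_vwalk_arcs_verts)

text \<open>Displacement from the start after \<open>i\<close> steps, before reduction modulo
  \<open>n\<close>; keeping it an integer lets distinctness and edge positions be read off from
  sizes.\<close>

definition bend_offset :: "int \<Rightarrow> int \<Rightarrow> nat \<Rightarrow> int" where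
  "bend_offset s a i = (if int i \<le> \<bar>a\<bar> then sgn a * int i else a + (int i - \<bar>a\<bar>) * s)"

definition bent_walk :: "int \<Rightarrow> int \<Rightarrow> int \<Rightarrow> int \<Rightarrow> int \<Rightarrow> int list" where
  "bent_walk n s a b x =
     map (\<lambda>i. (x + bend_offset s a i) mod n) [0..<Suc (nat \<bar>a\<bar> + nat b)]"

text \<open>Edges are recorded by a base point and a positive step length, whichever way a walk
  traverses them; both data can be recovered from the edge.\<close>

definition circulant_edge :: "int \<Rightarrow> int \<Rightarrow> int \<Rightarrow> int set" where
  "circulant_edge n g u = {u mod n, (u + g) mod n}"

lemma bend_offset_Suc:
  "bend_offset s a (Suc i) = bend_offset s a i + (if int i < \<bar>a\<bar> then sgn a else s)"
proof -
  consider "int i < \<bar>a\<bar>" | "int i = \<bar>a\<bar>" | "\<bar>a\<bar> < int i" by linarith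
  then show ?thesis
  proof cases
    case 2
    then have "sgn a * int i = a" by (simp add: sgn_mult_abs)
    with 2 show ?thesis by (simp add: bend_offset_def)
  qed (auto simp: bend_offset_def algebra_simps)
qed

lemma hd_bent_walk: "x \<in> {0..<n} \<Longrightarrow> hd (bent_walk n s a b x) = x"
  by (auto simp: bent_walk_def bend_offset_def hd_map simp del: upt_Suc)

lemma last_bent_walk:
  "0 \<le> b \<Longrightarrow> last (bent_walk n s a b x) = (x + a + b * s) mod n"
  by (auto simp: bent_walk_def bend_offset_def last_map algebra_simps sgn_if)

lemma bend_offset_bounds:
  assumes "0 \<le> b" "0 \<le> s" "i \<le> nat \<bar>a\<bar> + nat b"
  shows "min 0 a \<le> bend_offset s a i" "bend_offset s a i \<le> max 0 a + b * s"
proof -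
  have "0 \<le> b * s" using assms by simp
  moreover have "0 \<le> (int i - \<bar>a\<bar>) * s \<and> (int i - \<bar>a\<bar>) * s \<le> b * s" if "\<not> int i \<le> \<bar>a\<bar>"
    using that assms by (auto intro: mult_right_mono)
  ultimately show "min 0 a \<le> bend_offset s a i" "bend_offset s a i \<le> max 0 a + b * s"
    by (auto simp: bend_offset_def sgn_if abs_if min_def max_def split: if_splits)
qed

text \<open>The only danger is a negative \<open>a\<close>, where the long steps turn back over the
  unit segment. As \<open>2 * \<bar>a\<bar> \<le> s\<close>, the first long step already lands at
  \<open>\<bar>a\<bar>\<close> or beyond, past the start.\<close>

lemma bend_offset_neq:
  assumes "0 < s" "2 * \<bar>a\<bar> \<le> s" "i < j"
  shows "bend_offset s a i \<noteq> bend_offset s a j"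
proof (cases "int j \<le> \<bar>a\<bar>")
  case True
  then show ?thesis using assms by (auto simp: bend_offset_def sgn_if)
next
  case j: False
  show ?thesis
  proof (cases "int i \<le> \<bar>a\<bar>")
    case True
    define w where "w = (int j - \<bar>a\<bar>) * s"
    have "1 * s \<le> w" unfolding w_def using j assms by (intro mult_right_mono) auto
    moreover have "bend_offset s a j = a + w" "bend_offset s a i = sgn a * int i"
      using True j by (auto simp: bend_offset_def w_def)
    ultimately show ?thesis using True assms by (auto simp: sgn_if abs_if split: if_splits)
  next
    case False
    then show ?thesis using j assms by (auto simp: bend_offset_def)
  qed
qed

text \<open>All offsets lie in an interval of length \<open>\<bar>a\<bar> + b * s < n\<close>, so
  distinct offsets stay distinct modulo \<open>n\<close>.\<close>

lemma distinct_bent_walk: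
  assumes "0 < s" "2 * \<bar>a\<bar> \<le> s" "0 \<le> b" "\<bar>a\<bar> + b * s < n"
  shows "distinct (bent_walk n s a b x)"
proof -
  have "i = j" if ij: "i \<le> nat \<bar>a\<bar> + nat b" "j \<le> nat \<bar>a\<bar> + nat b"
    and eq: "(x + bend_offset s a i) mod n = (x + bend_offset s a j) mod n" for i j
  proof (rule ccontr)
    assume "i \<noteq> j"
    then have neq: "bend_offset s a i \<noteq> bend_offset s a j"
      using bend_offset_neq[OF assms(1,2)] by (metis nat_neq_iff)
    have "[x + bend_offset s a i = x + bend_offset s a j] (mod n)"
      using eq by (simp add: cong_def)
    moreover have "\<bar>(x + bend_offset s a i) - (x + bend_offset s a j)\<bar> < n"
      using bend_offset_bounds[OF assms(3) less_imp_le[OF assms(1)] ij(1)]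
        bend_offset_bounds[OF assms(3) less_imp_le[OF assms(1)] ij(2)] assms
      by (simp add: abs_if min_def max_def split: if_splits)
    ultimately show False using cong_small_diff_eq neq by fastforce
  qed
  then show ?thesis
    unfolding bent_walk_def distinct_map by (auto intro!: inj_onI simp del: upt_Suc)
qed

lemma circulant_symmetric:
  "(u, v) \<in> parcs (circulant n s) \<Longrightarrow> (v, u) \<in> parcs (circulant n s)"
proof -
  assume "(u, v) \<in> parcs (circulant n s)"
  then obtain d where d: "d \<in> {1, -1, s, -s}" "[u - v = d] (mod n)" "u \<in> {0..<n}" "v \<in> {0..<n}"
    by (auto simp: circulant_def)
  then have "-d \<in> {1, -1, s, -s}" "[v - u = -d] (mod n)"
    using cong_minus_minus_iff[of "u - v" d n] by auto
  then show ?thesis using d(3,4) unfolding circulant_def by auto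
qed

lemma vpath_bent_walk:
  assumes "0 < s" "2 * \<bar>a\<bar> \<le> s" "0 \<le> b" "\<bar>a\<bar> + b * s < n"
  shows "vpath (bent_walk n s a b x) (with_proj (circulant n s))"
proof -
  let ?f = "\<lambda>i. (x + bend_offset s a i) mod n"
  have "0 \<le> b * s" using assms by simp
  then have n: "0 < n" using assms by linarith
  have arc: "(?f i, ?f (Suc i)) \<in> parcs (circulant n s)" for i
  proof -
    have "[?f i - ?f (Suc i) = - (if int i < \<bar>a\<bar> then sgn a else s)] (mod n)"
      unfolding bend_offset_Suc cong_def by (simp add: mod_simps)
    moreover have "- (if int i < \<bar>a\<bar> then sgn a else s) \<in> {1, -1, s, -s}"
      by (auto simp: sgn_if)
    ultimately show ?thesis using n by (auto simp: circulant_def)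
  qed
  show ?thesis
    using distinct_bent_walk[OF assms] arc n
    by (auto simp: vpath_def vwalk_def bent_walk_def vwalk_arcs_map_upt circulant_def simp del: upt_Suc)
qed

lemma bent_walk_edge_cases:
  assumes "e \<in> vwalk_edges (bent_walk n s a b x)" "0 \<le> b"
  obtains t where "min 0 a \<le> t" "t < max 0 a" "e = circulant_edge n 1 (x + t)"
  | j where "0 \<le> j" "j < b" "e = circulant_edge n s (x + a + j * s)"
proof -
  obtain i where i: "i < nat \<bar>a\<bar> + nat b"
    "e = {(x + bend_offset s a i) mod n, (x + bend_offset s a (Suc i)) mod n}"
    using assms(1) by (auto simp: vwalk_edges_def bent_walk_def vwalk_arcs_map_upt simp del: upt_Suc)
  show ?thesis
  proof (cases "int i < \<bar>a\<bar>")
    case True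
    \<comment> \<open>For negative \<open>a\<close> the step from \<open>- i\<close> to
      \<open>- i - 1\<close> is recorded from its lower end, hence the offset
      \<open>- int i - 1\<close>.\<close>
    have "e = circulant_edge n 1 (x + (if 0 < a then int i else - int i - 1))"
      using True i(2) by (auto simp: bend_offset_Suc circulant_edge_def bend_offset_def sgn_if
        algebra_simps insert_commute)
    then show ?thesis
      using that(1)[of "if 0 < a then int i else - int i - 1"] True by (auto split: if_splits)
  next
    case False
    have "x + bend_offset s a i = x + a + (int i - \<bar>a\<bar>) * s"
      using False by (auto simp: bend_offset_def sgn_if)
    then have "e = circulant_edge n s (x + a + (int i - \<bar>a\<bar>) * s)"
      using False i(2) by (simp add: bend_offset_Suc circulant_edge_def flip: add.assoc)
    then show ?thesis using that(2)[of "int i - \<bar>a\<bar>"] False i(1) assms(2) by auto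
  qed
qed

text \<open>Matching the endpoints crosswise would give \<open>g + h\<close> congruent to 0, but
  \<open>0 < g + h < n\<close>. So base points match, and then so do the steps, both being below
  \<open>n / 2\<close>.\<close>

lemma circulant_edge_eqD:
  assumes "circulant_edge n g u = circulant_edge n h v"
    "0 < g" "0 < h" "2 * g < n" "2 * h < n"
  shows "[u = v] (mod n)" "g = h"
proof -
  have "[u = v] (mod n) \<and> [u + g = v + h] (mod n) \<or> [u = v + h] (mod n) \<and> [u + g = v] (mod n)"
    using assms(1) by (auto simp: circulant_edge_def doubleton_eq_iff cong_def)
  moreover have False if "[u = v + h] (mod n)" "[u + g = v] (mod n)"
  proof -
    have "[u + g = v + (h + g)] (mod n)"
      using cong_add[OF that(1) cong_refl[of g]] by (simp add: algebra_simps)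
    with that(2) have "[v + 0 = v + (h + g)] (mod n)" by (metis add.right_neutral cong_sym cong_trans)
    then have "[h + g = 0] (mod n)" by (metis cong_add_lcancel cong_sym)
    then show False using cong_small_diff_eq[of "h + g" 0 n] assms by auto
  qed
  ultimately have *: "[u = v] (mod n)" "[u + g = v + h] (mod n)" by auto
  then have "[u + g = u + h] (mod n)" by (meson cong_add_rcancel cong_sym cong_trans)
  then have "[g = h] (mod n)" by (simp only: cong_add_lcancel)
  then show "g = h" using cong_small_diff_eq[of g h n] assms by auto
  show "[u = v] (mod n)" by fact
qed

text \<open>A unit edge is never a long edge, so a shared edge lies in the unit parts of both walks
  or in the long parts of both. These are the two relations that \<open>circular_colouring\<close>
  separates.\<close>

lemma bent_walk_conflict:
  assumes "vwalk_edges (bent_walk n s a b x) \<inter> vwalk_edges (bent_walk n s a b y) \<noteq> {}"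
    and "1 < s" "2 * s < n" "0 \<le> b"
  shows "\<exists>k. \<bar>k\<bar> < \<bar>a\<bar> \<and> [x - y = k] (mod n) \<or> \<bar>k\<bar> < b \<and> [x - y = k * s] (mod n)"
proof -
  obtain e where e: "e \<in> vwalk_edges (bent_walk n s a b x)" "e \<in> vwalk_edges (bent_walk n s a b y)"
    using assms(1) by blast
  note D = circulant_edge_eqD[of n]
  have diff: "[x - y = w - v] (mod n)" if "[x + v = y + w] (mod n)" for v w
    using that by (simp add: cong_iff_dvd_diff algebra_simps)
  from e(1) assms(4) show ?thesis
  proof (cases rule: bent_walk_edge_cases)
    case x: (1 t)
    from e(2) assms(4) show ?thesis
    proof (cases rule: bent_walk_edge_cases)
      case y: (1 t')
      have "[x - y = t' - t] (mod n)" using D(1)[of 1 "x + t" 1 "y + t'"] x y assms diff by auto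
      moreover have "\<bar>t' - t\<bar> < \<bar>a\<bar>" using x y by (auto simp: abs_if min_def max_def split: if_splits)
      ultimately show ?thesis by blast
    next
      case y: (2 j)
      then show ?thesis using D(2)[of 1 "x + t" s "y + a + j * s"] x assms by auto
    qed
  next
    case x: (2 j)
    from e(2) assms(4) show ?thesis
    proof (cases rule: bent_walk_edge_cases)
      case y: (1 t)
      then show ?thesis using D(2)[of s "x + a + j * s" 1 "y + t"] x assms by auto
    next
      case y: (2 j')
      have "[x + (a + j * s) = y + (a + j' * s)] (mod n)"
        using D(1)[of s "x + a + j * s" s "y + a + j' * s"] x y assms by (auto simp: add.assoc)
      from diff[OF this] have "[x - y = (j' - j) * s] (mod n)" by (simp add: algebra_simps)
      moreover have "\<bar>j' - j\<bar> < b" using x y by (auto simp: abs_if)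
      ultimately show ?thesis by blast
    qed
  qed
qed

section \<open>Routings and the number of colours\<close>

lemma directed_optical_index_le:
  assumes "all_to_all_routing G R" "arc_conflict_free R c" "card (c ` R) \<le> K"
  shows "directed_optical_index G \<le> K"
proof -
  have "directed_optical_index G \<le> arc_colour_number R"
    unfolding directed_optical_index_def using assms(1) by (intro Least_le) blast
  also have "\<dots> \<le> card (c ` R)"
    unfolding arc_colour_number_def using assms(2) by (intro Least_le) blast
  finally show ?thesis using assms(3) by simp
qed

lemma undirected_optical_index_le:
  assumes "all_to_all_routing G R" "edge_conflict_free R c" "card (c ` R) \<le> K"
  shows "undirected_optical_index G \<le> K"
proof -
  have "undirected_optical_index G \<le> edge_colour_number R"
    unfolding undirected_optical_index_def using assms(1) by (intro Least_le) blast
  also have "\<dots> \<le> card (c ` R)"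
    unfolding edge_colour_number_def using assms(2) by (intro Least_le) blast
  finally show ?thesis using assms(3) by simp
qed

lemma vpath_rev:
  assumes "vpath p (with_proj G)" "\<And>u v. (u, v) \<in> parcs G \<Longrightarrow> (v, u) \<in> parcs G"
  shows "vpath (rev p) (with_proj G)"
  using assms by (auto simp: vpath_def vwalk_def vwalk_arcs_rev)

lemma card_image_le_bound: "c ` R \<subseteq> {..<K :: nat} \<Longrightarrow> card (c ` R) \<le> K"
  using card_mono[of "{..<K}" "c ` R"] by simp

text \<open>
  A path and its reversal never share an arc, so they may receive the same colour in the directed
  problem; the undirected problem needs a second copy of the palette.
\<close>
lemma optical_index_le_of_half_routing:
  fixes G :: "'a pair_pre_digraph" and F :: "('a \<times> 'a) set"
  assumes sym: "\<And>u v. (u, v) \<in> parcs G \<Longrightarrow> (v, u) \<in> parcs G"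
    and F_sub: "\<And>x y. (x, y) \<in> F \<Longrightarrow> x \<in> pverts G \<and> y \<in> pverts G \<and> x \<noteq> y"
    and F_asym: "\<And>x y. (x, y) \<in> F \<Longrightarrow> (y, x) \<notin> F"
    and F_total: "\<And>x y. x \<in> pverts G \<Longrightarrow> y \<in> pverts G \<Longrightarrow> x \<noteq> y \<Longrightarrow> (x, y) \<in> F \<or> (y, x) \<in> F"
    and path: "\<And>x y. (x, y) \<in> F \<Longrightarrow>
      vpath (P x y) (with_proj G) \<and> hd (P x y) = x \<and> last (P x y) = y"
    and col: "\<And>x y. (x, y) \<in> F \<Longrightarrow> col x y < K"
    and conflict: "\<And>x y x' y'. (x, y) \<in> F \<Longrightarrow> (x', y') \<in> F \<Longrightarrow> (x, y) \<noteq> (x', y') \<Longrightarrow>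
      vwalk_edges (P x y) \<inter> vwalk_edges (P x' y') \<noteq> {} \<Longrightarrow> col x y \<noteq> col x' y'"
  shows "directed_optical_index G \<le> K" and "undirected_optical_index G \<le> 2 * K"
    and "\<exists>R. all_to_all_routing G R"
proof -
  define R where "R = (\<lambda>(x, y). P x y) ` F \<union> (\<lambda>(x, y). rev (P x y)) ` F"
  have ne: "P x y \<noteq> []" if "(x, y) \<in> F" for x y
    using path[OF that] by (auto simp: vpath_def vwalk_def)
  have ends: "hd (P x y) = x" "last (P x y) = y" "hd (rev (P x y)) = y" "last (rev (P x y)) = x"
    if "(x, y) \<in> F" for x y
    using path[OF that] ne[OF that] by (auto simp: hd_rev last_rev)
  have R_cases: "\<exists>x y. (x, y) \<in> F \<and> (p = P x y \<or> p = rev (P x y))" if "p \<in> R" for p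
    using that by (auto simp: R_def)
  have routing: "all_to_all_routing G R"
    unfolding all_to_all_routing_def
  proof (intro conjI ballI impI)
    fix p assume "p \<in> R"
    then obtain x y where xy: "(x, y) \<in> F" "p = P x y \<or> p = rev (P x y)" using R_cases by blast
    then show "vpath p (with_proj G)" using path[OF xy(1)] vpath_rev[OF _ sym] by auto
    show "hd p \<noteq> last p" using xy ends[OF xy(1)] F_sub[OF xy(1)] by auto
  next
    fix x y assume xy: "x \<in> pverts G" "y \<in> pverts G" "x \<noteq> y"
    show "\<exists>!p. p \<in> R \<and> hd p = x \<and> last p = y"
    proof (cases "(x, y) \<in> F")
      case True
      show ?thesis
      proof (rule ex1I[of _ "P x y"])
        show "P x y \<in> R \<and> hd (P x y) = x \<and> last (P x y) = y"
          using True ends[OF True] by (auto simp: R_def)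
      next
        fix p assume p: "p \<in> R \<and> hd p = x \<and> last p = y"
        then obtain u v where uv: "(u, v) \<in> F" "p = P u v \<or> p = rev (P u v)" using R_cases by blast
        then show "p = P x y" using p ends[OF uv(1)] F_asym[OF True] by auto
      qed
    next
      case False
      then have F: "(y, x) \<in> F" using F_total xy by blast
      show ?thesis
      proof (rule ex1I[of _ "rev (P y x)"])
        show "rev (P y x) \<in> R \<and> hd (rev (P y x)) = x \<and> last (rev (P y x)) = y"
          using F ends[OF F] by (auto simp: R_def)
      next
        fix p assume p: "p \<in> R \<and> hd p = x \<and> last p = y"
        then obtain u v where uv: "(u, v) \<in> F" "p = P u v \<or> p = rev (P u v)" using R_cases by blast
        then show "p = rev (P y x)" using p ends[OF uv(1)] False by auto
      qed
    qed
  qed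
  show "\<exists>R. all_to_all_routing G R" using routing by blast
  define c where "c p = (if (hd p, last p) \<in> F then col (hd p) (last p) else col (last p) (hd p))"
    for p
  have c: "c (P x y) = col x y" "c (rev (P x y)) = col x y" if "(x, y) \<in> F" for x y
    using ends[OF that] that F_asym[OF that] by (auto simp: c_def)
  have c_lt: "c ` R \<subseteq> {..<K}" using c col by (auto simp: R_def)
  have same_pair: "x = x' \<and> y = y'"
    if "(x, y) \<in> F" "(x', y') \<in> F" "p = P x y \<or> p = rev (P x y)" "p' = P x' y' \<or> p' = rev (P x' y')"
      "vwalk_edges p \<inter> vwalk_edges p' \<noteq> {}" "c p = c p'" for p p' x y x' y'
  proof -
    have "vwalk_edges (P x y) \<inter> vwalk_edges (P x' y') \<noteq> {}" "col x y = col x' y'"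
      using that c[OF that(1)] c[OF that(2)] by auto
    then show ?thesis using conflict[OF that(1,2)] by blast
  qed
  have arc_free: "arc_conflict_free R c"
    unfolding arc_conflict_free_def
  proof (intro ballI impI notI)
    fix p p' assume p: "p \<in> R" "p' \<in> R"
      and pp': "p \<noteq> p' \<and> set (vwalk_arcs p) \<inter> set (vwalk_arcs p') \<noteq> {}" and eq: "c p = c p'"
    obtain x y where xy: "(x, y) \<in> F" "p = P x y \<or> p = rev (P x y)" using R_cases p by blast
    obtain x' y' where xy': "(x', y') \<in> F" "p' = P x' y' \<or> p' = rev (P x' y')" using R_cases p by blast
    have "vwalk_edges p \<inter> vwalk_edges p' \<noteq> {}" using pp' by (auto simp: vwalk_edges_def)
    \<comment> \<open>A shared edge and equal colours leave one pair of \<open>F\<close>, which has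
      only two routes, each the reversal of the other.\<close>
    then have "p' = rev p" using same_pair[OF xy(1) xy'(1) xy(2) xy'(2)] eq xy xy' pp' by auto
    moreover have "distinct p" using path[OF xy(1)] xy(2) by (auto simp: vpath_def)
    ultimately show False
      using pp' distinct_vwalk_arcs_asym[of p] by (auto simp: vwalk_arcs_rev)
  qed
  show "directed_optical_index G \<le> K"
    using directed_optical_index_le[OF routing arc_free] card_image_le_bound[OF c_lt] by simp
  define c' where "c' p = c p + (if (hd p, last p) \<in> F then 0 else K)" for p
  have c'_lt: "c' ` R \<subseteq> {..<2 * K}" using c_lt by (auto simp: c'_def)
  have c'_eq: "c p = c p' \<and> ((hd p, last p) \<in> F \<longleftrightarrow> (hd p', last p') \<in> F)"
    if "c' p = c' p'" "p \<in> R" "p' \<in> R" for p p'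
  proof -
    have "c p < K" "c p' < K" using c_lt that by auto
    then show ?thesis using that(1) by (auto simp: c'_def split: if_splits)
  qed
  have edge_free: "edge_conflict_free R c'"
    unfolding edge_conflict_free_def
  proof (intro ballI impI notI)
    fix p p' assume p: "p \<in> R" "p' \<in> R"
      and pp': "p \<noteq> p' \<and> vwalk_edges p \<inter> vwalk_edges p' \<noteq> {}" and eq: "c' p = c' p'"
    obtain x y where xy: "(x, y) \<in> F" "p = P x y \<or> p = rev (P x y)" using R_cases p by blast
    obtain x' y' where xy': "(x', y') \<in> F" "p' = P x' y' \<or> p' = rev (P x' y')" using R_cases p by blast
    \<comment> \<open>Equal values of \<open>c'\<close> also fix the palette, that is, the
      orientation, so the two routes of the pair are told apart.\<close>
    have pair: "x = x' \<and> y = y'"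
      using same_pair[OF xy(1) xy'(1) xy(2) xy'(2)] c'_eq[OF eq p] pp' by blast
    then show False
      using xy xy' pp' c'_eq[OF eq p] ends[OF xy(1)] F_asym[OF xy(1)] by auto
  qed
  show "undirected_optical_index G \<le> 2 * K"
    using undirected_optical_index_le[OF routing edge_free] card_image_le_bound[OF c'_lt] by simp
qed

section \<open>Splitting differences by rounding, and one palette per difference\<close>

definition round_quotient :: "int \<Rightarrow> int \<Rightarrow> int" where
  "round_quotient s d = (d + (s - 1) div 2) div s"

text \<open>\<open>round_quotient\<close> rounds to the nearest integer with ties going down. For
  even \<open>s\<close> the remainder can therefore be \<open>s / 2\<close> but not
  \<open>- s / 2\<close>, which is why positive and negative remainders are later counted with
  different widths.\<close>

definition round_remainder :: "int \<Rightarrow> int \<Rightarrow> int" where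
  "round_remainder s d = d - round_quotient s d * s"

lemma round_remainder_bounds:
  assumes "0 < s"
  shows "- ((s - 1) div 2) \<le> round_remainder s d" "round_remainder s d \<le> s div 2"
proof -
  define u where "u = (s - 1) div 2"
  have "round_remainder s d = (d + u) mod s - u"
    unfolding round_remainder_def round_quotient_def u_def[symmetric]
    by (simp add: minus_div_mult_eq_mod[symmetric])
  moreover have "0 \<le> (d + u) mod s" "(d + u) mod s < s" using assms by auto
  ultimately have "- u \<le> round_remainder s d" "round_remainder s d \<le> s - 1 - u" by linarith+
  then show "- ((s - 1) div 2) \<le> round_remainder s d" "round_remainder s d \<le> s div 2"
    unfolding u_def by linarith+
qed

text \<open>The class of difference \<open>e\<close> uses the interval of \<open>M e\<close> colours
  that starts at the total size of all earlier palettes; such intervals do not overlap.\<close>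

lemma prefix_sum_palettes_disjoint:
  fixes M :: "int \<Rightarrow> nat"
  assumes "1 \<le> e" "e < e'" "c < M e"
  shows "sum M {1..<e} + c < sum M {1..<e'}"
proof -
  have "sum M {1..<e} + M e = sum M (insert e {1..<e})" by simp
  also have "\<dots> \<le> sum M {1..<e'}" using assms by (intro sum_mono2) auto
  finally show ?thesis using assms(3) by linarith
qed

definition class_cost :: "int \<Rightarrow> int \<Rightarrow> nat" where
  "class_cost s d = nat (2 * max (round_quotient s d) (2 * \<bar>round_remainder s d\<bar>))"

text \<open>Each unordered pair is routed along its shorter cyclic displacement
  \<open>d \<le> n / 2\<close>. Paths of different \<open>d\<close> use disjoint palettes, so only
  conflicts inside one class matter. The existence of a routing is recorded because the lower bounds
  need the minima to be attained.\<close>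

lemma circulant_optical_index_le:
  assumes "1 < s" "2 * s < n"
  defines "K \<equiv> \<Sum>d = 1..n div 2. class_cost s d"
  shows "directed_optical_index (circulant n s) \<le> K"
    and "undirected_optical_index (circulant n s) \<le> 2 * K"
    and "\<exists>R. all_to_all_routing (circulant n s) R"
proof -
  let ?b = "round_quotient s" and ?a = "round_remainder s"
  have two: "2 \<le> s" using assms(1) by simp
  have ab: "d = ?a d + ?b d * s" for d by (simp add: round_remainder_def)
  have d: "2 * \<bar>?a d\<bar> \<le> s" "0 \<le> ?b d" "2 * ((?b d - 1) * s) \<le> n" "\<bar>?a d\<bar> + ?b d * s < n"
    "0 < \<bar>?a d\<bar> \<or> 0 < ?b d" if "1 \<le> d" "2 * d \<le> n" for d
  proof -
    show a: "2 * \<bar>?a d\<bar> \<le> s" using round_remainder_bounds[of s d] assms(1) by linarith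
    show b: "0 \<le> ?b d" unfolding round_quotient_def using assms that by (simp add: pos_imp_zdiv_nonneg_iff)
    \<comment> \<open>Here \<open>b * s = d - a \<le> n / 2 + s / 2\<close>, so taking away one
      \<open>s\<close> leaves less than \<open>n / 2\<close>.\<close>
    have "(?b d - 1) * s = ?b d * s - s" by (simp add: algebra_simps)
    then show "2 * ((?b d - 1) * s) \<le> n" using a ab[of d] that by linarith
    \<comment> \<open>The left side is at most \<open>d + 2 * \<bar>a\<bar> \<le> n / 2 + s\<close>,
      and \<open>s < n / 2\<close>.\<close>
    show "\<bar>?a d\<bar> + ?b d * s < n" using a ab[of d] that assms by linarith
    show "0 < \<bar>?a d\<bar> \<or> 0 < ?b d"
    proof (rule ccontr)
      assume "\<not> ?thesis"
      then have "?a d = 0" "?b d = 0" using b by auto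
      then show False using ab[of d] that by simp
    qed
  qed
  have "\<exists>col :: int \<Rightarrow> nat. (\<forall>x. col x < class_cost s d) \<and>
      (\<forall>x \<in> {0..<n}. \<forall>y \<in> {0..<n}. \<forall>k. x \<noteq> y \<longrightarrow>
        \<bar>k\<bar> < \<bar>?a d\<bar> \<and> [x - y = k] (mod n) \<or> \<bar>k\<bar> < ?b d \<and> [x - y = k * s] (mod n) \<longrightarrow>
        col x \<noteq> col y)" if dd: "1 \<le> d" "2 * d \<le> n" for d
  proof -
    obtain col :: "int \<Rightarrow> nat"
      where 1: "\<And>x. int (col x) < 2 * max (?b d) (2 * \<bar>?a d\<bar>)"
        and 2: "\<And>x y k. x \<in> {0..<n} \<Longrightarrow> y \<in> {0..<n} \<Longrightarrow> x \<noteq> y \<Longrightarrow> \<bar>k\<bar> < \<bar>?a d\<bar> \<Longrightarrow>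
             [x - y = k] (mod n) \<Longrightarrow> col x \<noteq> col y"
        and 3: "\<And>x y k. x \<in> {0..<n} \<Longrightarrow> y \<in> {0..<n} \<Longrightarrow> x \<noteq> y \<Longrightarrow> \<bar>k\<bar> < ?b d \<Longrightarrow>
             [x - y = k * s] (mod n) \<Longrightarrow> col x \<noteq> col y"
      using circular_colouring[OF two assms(2) abs_ge_zero d(1)[OF dd] d(2)[OF dd] d(3)[OF dd]
        d(5)[OF dd]] by blast
    have "col x < class_cost s d" for x using 1[of x] by (simp add: class_cost_def)
    then show ?thesis using 2 3 by blast
  qed
  then obtain col :: "int \<Rightarrow> int \<Rightarrow> nat"
    where col_lt: "\<And>d x. 1 \<le> d \<Longrightarrow> 2 * d \<le> n \<Longrightarrow> col d x < class_cost s d"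
      and col_neq: "\<And>d x y k. 1 \<le> d \<Longrightarrow> 2 * d \<le> n \<Longrightarrow> x \<in> {0..<n} \<Longrightarrow> y \<in> {0..<n} \<Longrightarrow> x \<noteq> y \<Longrightarrow>
        \<bar>k\<bar> < \<bar>?a d\<bar> \<and> [x - y = k] (mod n) \<or> \<bar>k\<bar> < ?b d \<and> [x - y = k * s] (mod n) \<Longrightarrow>
        col d x \<noteq> col d y"
    by metis
  define e where "e x y = (y - x) mod n" for x y
  \<comment> \<open>When \<open>2 * e x y = n\<close> both orientations are equally short;
    \<open>x < y\<close> breaks the tie so that \<open>F\<close> contains exactly one of
    them.\<close>
  define F where "F = {(x, y). x \<in> {0..<n} \<and> y \<in> {0..<n} \<and> x \<noteq> y \<and>
    (2 * e x y < n \<or> 2 * e x y = n \<and> x < y)}"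
  have n: "0 < n" using assms by linarith
  have e_val: "e x y = (if x \<le> y then y - x else y - x + n)"
    if "x \<in> {0..<n}" "y \<in> {0..<n}" for x y
  proof (cases "x \<le> y")
    case True
    then show ?thesis using that by (auto simp: e_def intro!: mod_pos_pos_trivial)
  next
    case False
    have "(y - x + n) mod n = y - x + n" using False that by (intro mod_pos_pos_trivial) auto
    then show ?thesis using False by (simp add: e_def)
  qed
  have F_e: "1 \<le> e x y" "2 * e x y \<le> n" "x \<in> {0..<n}" "y \<in> {0..<n}" "x \<noteq> y" if "(x, y) \<in> F" for x y
    using that e_val[of x y] by (auto simp: F_def)
  have target: "(x + e x y) mod n = y" if "(x, y) \<in> F" for x y
    using F_e[OF that] by (simp add: e_def mod_simps)
  define P where "P x y = bent_walk n s (?a (e x y)) (?b (e x y)) x" for x y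
  define c where "c x y = sum (class_cost s) {1..<e x y} + col (e x y) x" for x y
  have path: "vpath (P x y) (with_proj (circulant n s)) \<and> hd (P x y) = x \<and> last (P x y) = y"
    if "(x, y) \<in> F" for x y
  proof -
    note dd = d[OF F_e(1,2)[OF that]]
    have "last (P x y) = (x + (?a (e x y) + ?b (e x y) * s)) mod n"
      unfolding P_def using last_bent_walk[OF dd(2)] by (simp add: add.assoc)
    then have "last (P x y) = y" using ab[of "e x y"] target[OF that] by simp
    then show ?thesis
      using vpath_bent_walk[of s "?a (e x y)" "?b (e x y)" n x] dd assms(1) hd_bent_walk F_e(3)[OF that]
      unfolding P_def by auto
  qed
  have c_lt: "c x y < K" if "(x, y) \<in> F" for x y
  proof -
    have "c x y < sum (class_cost s) {1..<n div 2 + 1}"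
      unfolding c_def using F_e[OF that] col_lt by (intro prefix_sum_palettes_disjoint) auto
    also have "{1..<n div 2 + 1} = {1..n div 2}" by auto
    finally show ?thesis by (simp add: K_def)
  qed
  have conflict: "c x y \<noteq> c x' y'"
    if xy: "(x, y) \<in> F" and xy': "(x', y') \<in> F" and "(x, y) \<noteq> (x', y')"
      and sh: "vwalk_edges (P x y) \<inter> vwalk_edges (P x' y') \<noteq> {}" for x y x' y'
  proof -
    note f = F_e[OF xy] and f' = F_e[OF xy']
    consider "e x y < e x' y'" | "e x' y' < e x y" | "e x y = e x' y'" by linarith
    then show ?thesis
    proof cases
      case 1
      then show ?thesis
        using prefix_sum_palettes_disjoint[where M = "class_cost s", OF f(1) 1 col_lt[OF f(1,2), of x]] by (simp add: c_def)
    next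
      case 2
      then show ?thesis
        using prefix_sum_palettes_disjoint[where M = "class_cost s", OF f'(1) 2 col_lt[OF f'(1,2), of x']] by (simp add: c_def)
    next
      case 3
      then have "x \<noteq> x'" using target[OF xy] target[OF xy'] that(3) by auto
      moreover obtain k where "\<bar>k\<bar> < \<bar>?a (e x y)\<bar> \<and> [x - x' = k] (mod n) \<or>
          \<bar>k\<bar> < ?b (e x y) \<and> [x - x' = k * s] (mod n)"
        using bent_walk_conflict[OF sh[unfolded P_def 3[symmetric]] assms(1,2) d(2)[OF f(1,2)]] by blast
      ultimately have "col (e x y) x \<noteq> col (e x y) x'" using col_neq[OF f(1,2,3) f'(3)] by blast
      then show ?thesis using 3 by (simp add: c_def)
    qed
  qed
  have F_asym: "(y, x) \<notin> F" if "(x, y) \<in> F" for x y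
    using F_e[OF that] that e_val[of x y] e_val[of y x] by (auto simp: F_def split: if_splits)
  have F_total: "(x, y) \<in> F \<or> (y, x) \<in> F"
    if "x \<in> pverts (circulant n s)" "y \<in> pverts (circulant n s)" "x \<noteq> y" for x y
    using that e_val[of x y] e_val[of y x] by (auto simp: F_def circulant_def split: if_splits)
  have F_sub: "x \<in> pverts (circulant n s) \<and> y \<in> pverts (circulant n s) \<and> x \<noteq> y" if "(x, y) \<in> F" for x y
    using F_e[OF that] by (auto simp: circulant_def)
  note half = optical_index_le_of_half_routing[OF circulant_symmetric F_sub F_asym F_total path c_lt conflict]
  show "directed_optical_index (circulant n s) \<le> K" by (rule half(1))
  show "undirected_optical_index (circulant n s) \<le> 2 * K" by (rule half(2))
  show "\<exists>R. all_to_all_routing (circulant n s) R" by (rule half(3))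
qed

section \<open>Estimating the number of colours\<close>

text \<open>Palette sizes summed over a rectangle of quotients \<open>b\<close> and remainders
  \<open>a\<close> of one sign.\<close>

definition block_cost :: "int \<Rightarrow> int \<Rightarrow> int" where
  "block_cost A B = (\<Sum>b = 1..B. \<Sum>a = 1..A. 2 * max b (2 * a))"

lemma sum_int_Suc:
  fixes f :: "int \<Rightarrow> 'a::comm_monoid_add"
  shows "(\<Sum>i = 1..int (Suc k). f i) = (\<Sum>i = 1..int k. f i) + f (int k + 1)"
proof -
  have "{1..int (Suc k)} = insert (int k + 1) {1..int k}" by auto
  then show ?thesis by (simp add: add.commute)
qed

text \<open>The excess \<open>4 (b - 2 a)\<close> telescopes as a difference of consecutive values of \<open>(b - 1 - 2 a)\<^sup>2\<close>.\<close>
lemma row_cost_le: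
  fixes b :: int
  shows "2 * (\<Sum>a = 1..int k. 2 * max b (2 * a)) + (max (b - 1 - 2 * int k) 0)\<^sup>2
    \<le> 4 * int k * (int k + 1) + (b - 1)\<^sup>2"
proof (induction k)
  case 0
  then show ?case by (auto simp: max_def)
next
  case (Suc k)
  define K where "K = int k"
  have "4 * max b (2 * (K + 1)) + (max (b - 1 - 2 * (K + 1)) 0)\<^sup>2
      \<le> 8 * (K + 1) + (max (b - 1 - 2 * K) 0)\<^sup>2"
  proof (cases "2 * K + 3 \<le> b")
    case True
    then show ?thesis by (simp add: power2_eq_square algebra_simps)
  next
    case False
    then have "max b (2 * (K + 1)) = 2 * (K + 1)" "max (b - 1 - 2 * (K + 1)) 0 = 0" by auto
    then show ?thesis by simp
  qed
  then show ?case
    using Suc.IH unfolding sum_int_Suc K_def by (simp add: algebra_simps)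
qed

text \<open>Companion of \<open>row_cost_le\<close> with \<open>a\<close> fixed: for
  \<open>c = max (2 * a - k) 0\<close> the excess of \<open>4 * a\<close> over
  \<open>2 * (k + 1)\<close> is \<open>2 * (c - 1)\<close>, which telescopes as a difference of
  consecutive values of \<open>c * (c - 1)\<close>.\<close>

lemma column_cost_le:
  fixes a :: int
  assumes "1 \<le> a"
  shows "(\<Sum>b = 1..int k. 2 * max b (2 * a)) + max (2 * a - int k) 0 * (max (2 * a - int k) 0 - 1)
    \<le> int k * (int k + 1) + 2 * a * (2 * a - 1)"
proof (induction k)
  case 0
  then show ?case using assms by auto
next
  case (Suc k)
  define K where "K = int k"
  have "2 * max (K + 1) (2 * a) + max (2 * a - (K + 1)) 0 * (max (2 * a - (K + 1)) 0 - 1)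
      \<le> 2 * (K + 1) + max (2 * a - K) 0 * (max (2 * a - K) 0 - 1)"
  proof (cases "K + 1 \<le> 2 * a")
    case True
    then show ?thesis by (simp add: algebra_simps)
  next
    case False
    then have "max (K + 1) (2 * a) = K + 1" "max (2 * a - (K + 1)) 0 = 0" "max (2 * a - K) 0 = 0" by auto
    then show ?thesis by simp
  qed
  then show ?case
    using Suc.IH unfolding sum_int_Suc K_def by (simp add: algebra_simps)
qed

text \<open>Sums the row bounds after dropping their square terms. Those vanish for
  \<open>b \<le> 2 * A + 1\<close>, so the estimate is sharp up to small terms when \<open>B\<close>
  is at most about \<open>2 * A\<close>.\<close>

lemma block_cost_le_rows:
  assumes "0 \<le> A" "0 \<le> B"
  shows "24 * block_cost A B \<le> 48 * A * (A + 1) * B + 2 * (B - 1) * B * (2 * B - 1)"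
proof -
  obtain k l where kl: "A = int k" "B = int l" using assms nonneg_int_cases by metis
  have row: "2 * (\<Sum>a = 1..int k. 2 * max b (2 * a)) \<le> 4 * int k * (int k + 1) + (b - 1)\<^sup>2" for b
    using row_cost_le[where k = k and b = b] zero_le_power2[of "max (b - 1 - 2 * int k) 0"] by linarith
  have "24 * block_cost (int k) (int l) \<le>
      48 * int k * (int k + 1) * int l + 2 * (int l - 1) * int l * (2 * int l - 1)"
  proof (induction l)
    case 0
    then show ?case by (simp add: block_cost_def)
  next
    case (Suc l)
    have "block_cost (int k) (int (Suc l)) =
        block_cost (int k) (int l) + (\<Sum>a = 1..int k. 2 * max (int l + 1) (2 * a))"
      unfolding block_cost_def by (rule sum_int_Suc)
    then show ?case
      using Suc.IH row[of "int l + 1"] by (simp add: algebra_simps power2_eq_square)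
  qed
  then show ?thesis by (simp add: kl)
qed

text \<open>Sums the column bounds after dropping \<open>c * (c - 1)\<close>, which is nonnegative
  for every integer \<open>c\<close>. The dropped terms vanish when
  \<open>2 * A \<le> B + 1\<close>, so this is the estimate for tall blocks.\<close>

lemma block_cost_le_columns:
  assumes "0 \<le> A" "0 \<le> B"
  shows "24 * block_cost A B \<le> 24 * A * B * (B + 1) + 8 * A * (A + 1) * (4 * A - 1)"
proof -
  obtain k l where kl: "A = int k" "B = int l" using assms nonneg_int_cases by metis
  have nn: "0 \<le> x * (x - 1)" for x :: int by (cases "x \<le> 0") (auto intro: mult_nonpos_nonpos)
  have col: "(\<Sum>b = 1..int l. 2 * max b (2 * a)) \<le> int l * (int l + 1) + 2 * a * (2 * a - 1)"
    if "1 \<le> a" for a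
    using column_cost_le[OF that, of l] nn[of "max (2 * a - int l) 0"] by linarith
  have swap: "block_cost A' B' = (\<Sum>a = 1..A'. \<Sum>b = 1..B'. 2 * max b (2 * a))" for A' B'
    unfolding block_cost_def by (rule sum.swap)
  have "24 * block_cost (int k) (int l) \<le>
      24 * int k * int l * (int l + 1) + 8 * int k * (int k + 1) * (4 * int k - 1)"
  proof (induction k)
    case 0
    then show ?case by (simp add: block_cost_def)
  next
    case (Suc k)
    have "block_cost (int (Suc k)) (int l) =
        block_cost (int k) (int l) + (\<Sum>b = 1..int l. 2 * max b (2 * (int k + 1)))"
      unfolding swap by (rule sum_int_Suc)
    then show ?case
      using Suc.IH col[of "int k + 1"] by (simp add: algebra_simps)
  qed
  then show ?thesis by (simp add: kl)
qed

text \<open>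
  The pair \<open>(b, a)\<close> determines \<open>d\<close>; the top row \<open>b = (q + 1) div 2\<close> for odd \<open>q\<close> contains only negative \<open>a\<close>.
\<close>
lemma sum_class_cost_le:
  fixes n s q :: int
  assumes "1 < s" "q * s \<le> n" "n < (q + 1) * s" "2 \<le> q"
  defines "A \<equiv> s div 2" and "B \<equiv> (q + 1) div 2"
  shows "int (\<Sum>d = 1..n div 2. class_cost s d) \<le>
    2 * A * (A + 1) + (q div 2) * (q div 2 + 1) + block_cost A (q div 2) + block_cost ((s - 1) div 2) B"
proof -
  let ?b = "round_quotient s" and ?a = "round_remainder s"
  define A' where "A' = (s - 1) div 2"
  define B' where "B' = q div 2"
  define g where "g = (\<lambda>(b, a). 2 * max b (2 * \<bar>a\<bar>) :: int)"
  \<comment> \<open>The pieces are \<open>b = 0\<close>, \<open>a = 0\<close>, positive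
    \<open>a\<close> and negative \<open>a\<close>. Only the last may reach the row
    \<open>B\<close>, since a negative remainder lets \<open>b * s\<close> exceed
    \<open>n / 2\<close>.\<close>
  define S where "S = {0} \<times> {1..A} \<union> {1..B'} \<times> {0} \<union> {1..B'} \<times> {1..A} \<union> {1..B} \<times> {- A'..- 1}"
  have rem: "?a d = d - ?b d * s" for d by (simp add: round_remainder_def)
  have g_nonneg: "0 \<le> g p" for p by (auto simp: g_def split: prod.splits)
  have in_S: "(?b d, ?a d) \<in> S" if d: "d \<in> {1..n div 2}" for d
  proof -
    have a: "- A' \<le> ?a d" "?a d \<le> A"
      using round_remainder_bounds[of s d] assms(1) by (auto simp: A_def A'_def)
    have b: "0 \<le> ?b d"
      unfolding round_quotient_def using assms(1) d by (simp add: pos_imp_zdiv_nonneg_iff)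
    have n2: "2 * ?a d + 2 * ?b d * s \<le> n"
    proof -
      have "2 * d \<le> n" using d by auto
      moreover have "2 * d = 2 * ?a d + 2 * ?b d * s"
        unfolding rem by (simp add: algebra_simps)
      ultimately show ?thesis by linarith
    qed
    have sA: "2 * A' < s" unfolding A'_def by linarith
    \<comment> \<open>A remainder of at least \<open>- A'\<close> contributes less than
      \<open>s\<close> beyond \<open>n < (q + 1) * s\<close>.\<close>
    have "2 * ?b d * s < (q + 2) * s" using n2 a(1) sA assms(3) by (simp add: algebra_simps)
    from mult_right_less_imp_less[OF this] have "2 * ?b d < q + 2" using assms(1) by simp
    then have bB: "?b d \<le> B" by (auto simp: B_def)
    have bB': "?b d \<le> B'" if "0 \<le> ?a d"
    proof -
      have "2 * ?b d * s < (q + 1) * s" using n2 that assms(3) by linarith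
      from mult_right_less_imp_less[OF this] have "2 * ?b d < q + 1" using assms(1) by simp
      then show ?thesis by (auto simp: B'_def)
    qed
    have b1: "1 \<le> ?b d" if "?a d \<le> 0"
    proof (rule ccontr)
      assume "\<not> 1 \<le> ?b d"
      then have "?b d = 0" using b by simp
      then show False using rem[of d] that d by simp
    qed
    show ?thesis
      unfolding S_def using a b bB bB' b1
      by (cases "?b d = 0"; cases "?a d" "0::int" rule: linorder_cases) auto
  qed
  have "int (\<Sum>d = 1..n div 2. class_cost s d) = (\<Sum>d = 1..n div 2. g (?b d, ?a d))"
    unfolding of_nat_sum by (intro sum.cong) (auto simp: class_cost_def g_def)
  also have "\<dots> = sum g ((\<lambda>d. (?b d, ?a d)) ` {1..n div 2})"
  proof -
    have "inj_on (\<lambda>d. (?b d, ?a d)) {1..n div 2}"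
    proof (rule inj_onI)
      fix x y assume "(?b x, ?a x) = (?b y, ?a y)"
      then have eq: "?b x = ?b y" "?a x = ?a y" by (simp_all only: prod.inject)
      have "x = ?a x + ?b x * s" by (simp add: rem)
      also have "\<dots> = ?a y + ?b y * s" by (simp only: eq)
      finally show "x = y" by (simp add: rem)
    qed
    then show ?thesis by (simp add: sum.reindex)
  qed
  also have "\<dots> \<le> sum g S"
  proof (rule sum_mono2)
    show "finite S" by (simp add: S_def)
    show "(\<lambda>d. (?b d, ?a d)) ` {1..n div 2} \<subseteq> S" using in_S by blast
  qed (rule g_nonneg)
  also have "\<dots> \<le> sum g ({0} \<times> {1..A}) + sum g ({1..B'} \<times> {0}) + sum g ({1..B'} \<times> {1..A})
      + sum g ({1..B} \<times> {- A'..- 1})"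
  proof -
    have un: "sum g (X \<union> Y) \<le> sum g X + sum g Y" if "finite X" "finite Y" for X Y
      using sum.union_inter[OF that, of g] sum_nonneg[of "X \<inter> Y" g] g_nonneg by auto
    have "sum g (X1 \<union> X2 \<union> X3 \<union> X4) \<le> sum g X1 + sum g X2 + sum g X3 + sum g X4"
      if "finite X1" "finite X2" "finite X3" "finite X4" for X1 X2 X3 X4
      using un[of "X1 \<union> X2 \<union> X3" X4] un[of "X1 \<union> X2" X3] un[of X1 X2] that by simp
    from this[of "{0} \<times> {1..A}" "{1..B'} \<times> {0}" "{1..B'} \<times> {1..A}" "{1..B} \<times> {- A'..- 1}"]
    show ?thesis unfolding S_def by simp
  qed
  also have "sum g ({0} \<times> {1..A}) = 2 * A * (A + 1)"
  proof -
    have "(\<Sum>a = 1..int k. 4 * a) = 2 * int k * (int k + 1)" for k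
    proof (induction k)
      case (Suc k)
      then show ?case unfolding sum_int_Suc by (simp add: algebra_simps)
    qed simp
    from this[of "nat A"] have "(\<Sum>a = 1..A. 4 * a) = 2 * A * (A + 1)" using assms(1) by (simp add: A_def)
    moreover have "sum g ({0} \<times> {1..A}) = (\<Sum>a = 1..A. 4 * a)"
      by (simp add: sum.cartesian_product[symmetric] g_def)
    ultimately show ?thesis by simp
  qed
  also have "sum g ({1..B'} \<times> {0}) = B' * (B' + 1)"
  proof -
    have "(\<Sum>b = 1..int k. 2 * b) = int k * (int k + 1)" for k
    proof (induction k)
      case (Suc k)
      then show ?case unfolding sum_int_Suc by (simp add: algebra_simps)
    qed simp
    from this[of "nat B'"] have "(\<Sum>b = 1..B'. 2 * b) = B' * (B' + 1)" using assms(4) by (simp add: B'_def)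
    moreover have "sum g ({1..B'} \<times> {0}) = (\<Sum>b = 1..B'. 2 * b)"
      by (simp add: sum.cartesian_product[symmetric] g_def)
    ultimately show ?thesis by simp
  qed
  also have "sum g ({1..B'} \<times> {1..A}) = block_cost A B'"
    by (simp add: sum.cartesian_product[symmetric] g_def block_cost_def)
  also have "sum g ({1..B} \<times> {- A'..- 1}) = block_cost A' B"
  proof -
    have "(\<Sum>a = - A'..- 1. 2 * max b (2 * \<bar>a\<bar>)) = (\<Sum>a = 1..A'. 2 * max b (2 * a))" for b
      by (rule sum.reindex_bij_witness[of _ uminus uminus]) auto
    then show ?thesis
      by (simp add: sum.cartesian_product[symmetric] g_def block_cost_def)
  qed
  finally show ?thesis by (simp add: A'_def B'_def)
qed

section \<open>Polynomial inequalities for the three regimes\<close>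

lemma cubic_monomials_nonneg:
  fixes j k :: int
  assumes "0 \<le> j" "0 \<le> k"
  shows "0 \<le> j * j" "0 \<le> j * k" "0 \<le> k * k"
    "0 \<le> j * (j * j)" "0 \<le> j * (j * k)" "0 \<le> j * (k * k)" "0 \<le> k * (k * k)"
  using assms by auto

lemma scaled_add_le:
  fixes X :: int
  assumes "24 * X + R1 + R2 \<le> Z" "24 * T1 \<le> R1" "24 * T2 \<le> R2"
  shows "24 * (X + T1 + T2) \<le> Z"
  using assms by (simp add: distrib_left)

text \<open>Regime of (a). The left side is 24 times the bound of \<open>sum_class_cost_le\<close>,
  with \<open>e\<close> and \<open>f\<close> the parities of \<open>q\<close> and \<open>s\<close>.
  The split at \<open>B = 2 * A\<close> chooses between row and column estimates.\<close>

lemma cost_le_many_rows: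
  fixes A B e f :: int
  assumes "e \<in> {0, 1}" "f \<in> {0, 1}" "1 \<le> A" "A + 2 \<le> B"
    and "q = 2 * B - e" "s = 2 * A + f"
  shows "24 * (2 * A * (A + 1) + (B - e) * (B - e + 1) + block_cost A (B - e) + block_cost (A - 1 + f) B)
    \<le> (s + 2) * (6 * q\<^sup>2 + 3 * q * (s + 4) + s * (4 * s + 10) + e * (2 * q + 3 * s + 3))"
proof (cases "B \<le> 2 * A")
  case True
  \<comment> \<open>\<open>k = B - A - 2\<close> and \<open>j = 2 * A - B\<close> are the slacks of
    the two constraints on \<open>B\<close>.\<close>
  obtain j k where jk: "0 \<le> j" "0 \<le> k" "A = 2 + j + k" "B = 4 + j + 2 * k"
  proof -
    define k where "k = B - A - 2"
    define j where "j = A - 2 - k"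
    show ?thesis by (rule that[of j k]) (use True assms in \<open>auto simp: j_def k_def\<close>)
  qed
  \<comment> \<open>After substituting nonnegative slacks and expanding, linear arithmetic settles
    each parity case, with the monomials in \<open>j\<close> and \<open>k\<close> as nonnegative
    atoms.\<close>
  have "24 * (2 * A * (A + 1) + (B - e) * (B - e + 1)) + (48 * A * (A + 1) * (B - e) + 2 * (B - e - 1) * (B - e) * (2 * (B - e) - 1))
    + (48 * (A - 1 + f) * (A - 1 + f + 1) * B + 2 * (B - 1) * B * (2 * B - 1))
    \<le> (s + 2) * (6 * q\<^sup>2 + 3 * q * (s + 4) + s * (4 * s + 10) + e * (2 * q + 3 * s + 3))"
    using assms(1,2) cubic_monomials_nonneg[OF jk(1,2)] jk(1,2) unfolding assms(5,6) jk(3,4)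
    by (elim insertE emptyE; simp add: algebra_simps power2_eq_square)
  note total = this
  have "0 \<le> A" "0 \<le> B - e" "0 \<le> A - 1 + f" "0 \<le> B" using assms(1-4) by auto
  from block_cost_le_rows[OF this(1,2)] block_cost_le_rows[OF this(3,4)]
  show ?thesis by (rule scaled_add_le[OF total])
next
  case False
  \<comment> \<open>Now the slacks are those of \<open>1 \<le> A\<close> and
    \<open>2 * A \<le> B\<close>.\<close>
  obtain j k where jk: "0 \<le> j" "0 \<le> k" "A = 1 + j" "B = 2 + 2 * j + k"
  proof -
    define k where "k = B - 2 * A"
    define j where "j = A - 1"
    show ?thesis by (rule that[of j k]) (use False assms in \<open>auto simp: j_def k_def\<close>)
  qed
  have "24 * (2 * A * (A + 1) + (B - e) * (B - e + 1)) + (24 * A * (B - e) * (B - e + 1) + 8 * A * (A + 1) * (4 * A - 1))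
    + (24 * (A - 1 + f) * B * (B + 1) + 8 * (A - 1 + f) * (A - 1 + f + 1) * (4 * (A - 1 + f) - 1))
    \<le> (s + 2) * (6 * q\<^sup>2 + 3 * q * (s + 4) + s * (4 * s + 10) + e * (2 * q + 3 * s + 3))"
    using assms(1,2) cubic_monomials_nonneg[OF jk(1,2)] jk(1,2) unfolding assms(5,6) jk(3,4)
    by (elim insertE emptyE; simp add: algebra_simps power2_eq_square)
  note total = this
  have "0 \<le> A" "0 \<le> B - e" "0 \<le> A - 1 + f" "0 \<le> B" using assms(1-4) by auto
  from block_cost_le_columns[OF this(1,2)] block_cost_le_columns[OF this(3,4)]
  show ?thesis by (rule scaled_add_le[OF total])
qed

text \<open>Regime of (b), where \<open>B\<close> is \<open>A\<close> or \<open>A + 1\<close>: one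
  free variable remains, and blocks this low suit the row estimate.\<close>

lemma cost_le_balanced:
  fixes A B e f :: int
  assumes "e \<in> {0, 1}" "f \<in> {0, 1}" "1 \<le> A" "1 + e \<le> B" "B = A \<or> B = A + 1"
    and "q = 2 * B - e" "s = 2 * A + f"
  shows "24 * (2 * A * (A + 1) + (B - e) * (B - e + 1) + block_cost A (B - e) + block_cost (A - 1 + f) B)
    \<le> q * (q + 2) * (5 * q + 2) + 4 * s * (s + 2) * (2 * s + 5) + e * 3 * (5 * q\<^sup>2 + 13 * q + 7)"
proof -
  obtain j where j: "0 \<le> j" "A = 1 + j" using assms(3) by (metis le_add_diff_inverse diff_ge_0_iff_ge)
  have "24 * (2 * A * (A + 1) + (B - e) * (B - e + 1)) + (48 * A * (A + 1) * (B - e) + 2 * (B - e - 1) * (B - e) * (2 * (B - e) - 1))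
    + (48 * (A - 1 + f) * (A - 1 + f + 1) * B + 2 * (B - 1) * B * (2 * B - 1))
    \<le> q * (q + 2) * (5 * q + 2) + 4 * s * (s + 2) * (2 * s + 5) + e * 3 * (5 * q\<^sup>2 + 13 * q + 7)"
    using assms(1,2,5) cubic_monomials_nonneg[OF j(1) j(1)] j(1) unfolding assms(6,7) j(2)
    by (elim insertE emptyE disjE; simp add: algebra_simps power2_eq_square)
  note total = this
  have "0 \<le> A" "0 \<le> B - e" "0 \<le> A - 1 + f" "0 \<le> B" using assms(1-4) by auto
  from block_cost_le_rows[OF this(1,2)] block_cost_le_rows[OF this(3,4)]
  show ?thesis by (rule scaled_add_le[OF total])
qed

text \<open>Regime of (c). Blocks are wider than high, so the row estimate applies; \<open>j\<close>
  and \<open>k\<close> are the slacks of \<open>1 + e \<le> B\<close> and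
  \<open>B + 1 \<le> A\<close>.\<close>

lemma cost_le_few_rows:
  fixes A B e f :: int
  assumes "e \<in> {0, 1}" "f \<in> {0, 1}" "1 + e \<le> B" "B + 1 \<le> A"
    and "q = 2 * B - e" "s = 2 * A + f"
  shows "24 * (2 * A * (A + 1) + (B - e) * (B - e + 1) + block_cost A (B - e) + block_cost (A - 1 + f) B)
    \<le> q * (q + 2) * (q + 10) + 12 * s * (s + 2) * (q + 1) + e * 3 * ((q + 5)\<^sup>2 + 4 * (s + 1)\<^sup>2)"
proof -
  define j where "j = B - 1 - e"
  define k where "k = A - B - 1"
  have jk: "0 \<le> j" "0 \<le> k" and B: "B = 1 + e + j" and A: "A = 2 + e + j + k"
    using assms by (auto simp: j_def k_def)
  have "24 * (2 * A * (A + 1) + (B - e) * (B - e + 1)) + (48 * A * (A + 1) * (B - e) + 2 * (B - e - 1) * (B - e) * (2 * (B - e) - 1))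
    + (48 * (A - 1 + f) * (A - 1 + f + 1) * B + 2 * (B - 1) * B * (2 * B - 1))
    \<le> q * (q + 2) * (q + 10) + 12 * s * (s + 2) * (q + 1) + e * 3 * ((q + 5)\<^sup>2 + 4 * (s + 1)\<^sup>2)"
    using assms(1,2) cubic_monomials_nonneg[OF jk] jk unfolding assms(5,6) A B
    by (elim insertE emptyE; simp add: algebra_simps power2_eq_square)
  note total = this
  have "0 \<le> A" "0 \<le> B - e" "0 \<le> A - 1 + f" "0 \<le> B" using assms(1-4) by auto
  from block_cost_le_rows[OF this(1,2)] block_cost_le_rows[OF this(3,4)]
  show ?thesis by (rule scaled_add_le[OF total])
qed

section \<open>Load and lower bounds\<close>

text \<open>Makes routings of finite graphs finite and turns sums over paths into sums over ordered
  pairs of vertices.\<close>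

lemma routing_bij_betw:
  assumes "all_to_all_routing G R"
  shows "bij_betw (\<lambda>p. (hd p, last p)) R {(x, y). x \<in> pverts G \<and> y \<in> pverts G \<and> x \<noteq> y}"
proof -
  have ends: "hd p \<in> pverts G \<and> last p \<in> pverts G \<and> hd p \<noteq> last p" if "p \<in> R" for p
  proof -
    have "vpath p (with_proj G)" "hd p \<noteq> last p" using assms that by (auto simp: all_to_all_routing_def)
    then have "set p \<subseteq> pverts G" "p \<noteq> []" by (auto simp: vpath_def vwalk_def)
    then show ?thesis using \<open>hd p \<noteq> last p\<close> by (meson hd_in_set last_in_set subsetD)
  qed
  have ex1: "\<exists>!p. p \<in> R \<and> hd p = x \<and> last p = y"
    if "x \<in> pverts G" "y \<in> pverts G" "x \<noteq> y" for x y
    using assms that by (auto simp: all_to_all_routing_def)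
  show ?thesis
    unfolding bij_betw_def
  proof (intro conjI inj_onI)
    fix p p' assume p: "p \<in> R" "p' \<in> R" "(hd p, last p) = (hd p', last p')"
    then show "p = p'" using ex1[of "hd p" "last p"] ends[of p] by auto
  next
    show "(\<lambda>p. (hd p, last p)) ` R = {(x, y). x \<in> pverts G \<and> y \<in> pverts G \<and> x \<noteq> y}"
    proof (intro equalityI subsetI)
      fix z assume "z \<in> {(x, y). x \<in> pverts G \<and> y \<in> pverts G \<and> x \<noteq> y}"
      then obtain p where "p \<in> R" "z = (hd p, last p)" using ex1 by (auto dest!: ex1_implies_ex)
      then show "z \<in> (\<lambda>p. (hd p, last p)) ` R" by blast
    qed (use ends in auto)
  qed
qed

lemma finite_routing:
  assumes "all_to_all_routing G R" "finite (pverts G)"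
  shows "finite R"
proof -
  have "finite {(x, y). x \<in> pverts G \<and> y \<in> pverts G \<and> x \<noteq> y}"
    by (rule finite_subset[of _ "pverts G \<times> pverts G"]) (use assms(2) in auto)
  then show ?thesis using routing_bij_betw[OF assms(1)] by (simp add: bij_betw_finite)
qed

text \<open>Both nested minima are attained: a routing exists, and a finite routing has an injective
  colouring, which is conflict-free. Abstracting \<open>conflict_free\<close> covers arcs and edges
  at once.\<close>

lemma exists_optimal_routing:
  fixes conflict_free :: "'a vwalk set \<Rightarrow> ('a vwalk \<Rightarrow> nat) \<Rightarrow> bool"
  assumes "all_to_all_routing G R\<^sub>0" "finite (pverts G)"
    and inj: "\<And>R c. inj_on c R \<Longrightarrow> conflict_free R c"
  defines "w \<equiv> \<lambda>R. LEAST k. \<exists>c. conflict_free R c \<and> card (c ` R) = k"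
  obtains R c where "all_to_all_routing G R" "conflict_free R c"
    "card (c ` R) = (LEAST k. \<exists>R. all_to_all_routing G R \<and> w R = k)"
proof -
  have "\<exists>R. all_to_all_routing G R \<and> w R = (LEAST k. \<exists>R. all_to_all_routing G R \<and> w R = k)"
    by (rule LeastI_ex) (use assms(1) in blast)
  then obtain R where R: "all_to_all_routing G R"
    "w R = (LEAST k. \<exists>R. all_to_all_routing G R \<and> w R = k)" by blast
  obtain f :: "'a vwalk \<Rightarrow> nat" where "inj_on f R"
    using finite_imp_inj_to_nat_seg[OF finite_routing[OF R(1) assms(2)]] by blast
  then have "\<exists>k c. conflict_free R c \<and> card (c ` R) = k" using inj by blast
  then have "\<exists>c. conflict_free R c \<and> card (c ` R) = w R"
    unfolding w_def by (rule LeastI_ex)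
  then show ?thesis using that R by auto
qed

definition load :: "'a vwalk set \<Rightarrow> 'a \<times> 'a \<Rightarrow> nat" where
  "load R e = card {p \<in> R. e \<in> set (vwalk_arcs p)}"

lemma card_le_of_conflict:
  assumes "finite R" "S \<subseteq> R" "\<And>p p'. p \<in> S \<Longrightarrow> p' \<in> S \<Longrightarrow> p \<noteq> p' \<Longrightarrow> c p \<noteq> c p'"
  shows "card S \<le> card (c ` R)"
proof -
  have "inj_on c S" using assms(3) by (auto intro!: inj_onI)
  then have "card S = card (c ` S)" by (simp add: card_image)
  also have "\<dots> \<le> card (c ` R)" using assms(1,2) by (intro card_mono) auto
  finally show ?thesis .
qed

text \<open>Double counting of incidences between paths and arcs.\<close>

lemma weighted_length_eq_load:
  fixes wt :: "'a \<times> 'a \<Rightarrow> real"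
  assumes "all_to_all_routing G R" "finite R" "finite (parcs G)"
  shows "(\<Sum>p\<in>R. \<Sum>e\<in>set (vwalk_arcs p). wt e) = (\<Sum>e\<in>parcs G. wt e * load R e)"
proof -
  have sub: "set (vwalk_arcs p) \<subseteq> parcs G" if "p \<in> R" for p
    using assms(1) that by (auto simp: all_to_all_routing_def vpath_def vwalk_def)
  have "(\<Sum>p\<in>R. \<Sum>e\<in>set (vwalk_arcs p). wt e) = (\<Sum>p\<in>R. \<Sum>e | e \<in> parcs G \<and> e \<in> set (vwalk_arcs p). wt e)"
    using sub by (intro sum.cong) (auto intro: arg_cong[where f = "sum wt"])
  also have "\<dots> = (\<Sum>e\<in>parcs G. \<Sum>p | p \<in> R \<and> e \<in> set (vwalk_arcs p). wt e)"
    using assms(2,3) by (rule sum.swap_restrict)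
  finally show ?thesis by (simp add: load_def mult.commute)
qed

lemma directed_optical_index_ge_load:
  fixes wt :: "'a \<times> 'a \<Rightarrow> real"
  assumes "all_to_all_routing G R\<^sub>0" "finite (pverts G)" "finite (parcs G)"
    and wt: "\<And>e. 0 \<le> wt e"
  shows "\<exists>R. all_to_all_routing G R \<and>
    (\<Sum>p\<in>R. \<Sum>e\<in>set (vwalk_arcs p). wt e) \<le> directed_optical_index G * (\<Sum>e\<in>parcs G. wt e)"
proof -
  have "arc_conflict_free R c" if "inj_on c R" for R :: "'a vwalk set" and c
    using that by (auto simp: arc_conflict_free_def dest: inj_onD)
  then obtain R c where R: "all_to_all_routing G R" "arc_conflict_free R c"
    "card (c ` R) = directed_optical_index G"
    using exists_optimal_routing[OF assms(1,2), of arc_conflict_free]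
    unfolding directed_optical_index_def arc_colour_number_def by blast
  have fin: "finite R" using finite_routing[OF R(1) assms(2)] .
  have "load R e \<le> directed_optical_index G" for e
    unfolding load_def R(3)[symmetric]
    by (rule card_le_of_conflict[OF fin]) (use R(2) in \<open>auto simp: arc_conflict_free_def\<close>)
  then have "(\<Sum>e\<in>parcs G. wt e * load R e) \<le> (\<Sum>e\<in>parcs G. wt e * directed_optical_index G)"
    by (intro sum_mono mult_left_mono wt) simp
  then show ?thesis
    using R(1) weighted_length_eq_load[OF R(1) fin assms(3), of wt]
    by (auto simp: sum_distrib_left mult.commute)
qed

text \<open>A path uses an edge in at most one direction, so the loads of its two orientations count
  disjoint sets of pairwise conflicting paths and add up to at most the index. Averaging over the
  orientations, which carry equal weight, gives the factor 1/2.\<close>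

lemma undirected_optical_index_ge_load:
  fixes wt :: "'a \<times> 'a \<Rightarrow> real"
  assumes "all_to_all_routing G R\<^sub>0" "finite (pverts G)" "finite (parcs G)"
    and wt: "\<And>e. 0 \<le> wt e" "\<And>u v. wt (u, v) = wt (v, u)"
    and sym: "\<And>u v. (u, v) \<in> parcs G \<Longrightarrow> (v, u) \<in> parcs G"
  shows "\<exists>R. all_to_all_routing G R \<and>
    (\<Sum>p\<in>R. \<Sum>e\<in>set (vwalk_arcs p). wt e) \<le> undirected_optical_index G / 2 * (\<Sum>e\<in>parcs G. wt e)"
proof -
  have "edge_conflict_free R c" if "inj_on c R" for R :: "'a vwalk set" and c
    using that by (auto simp: edge_conflict_free_def dest: inj_onD)
  then obtain R c where R: "all_to_all_routing G R" "edge_conflict_free R c"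
    "card (c ` R) = undirected_optical_index G"
    using exists_optimal_routing[OF assms(1,2), of edge_conflict_free]
    unfolding undirected_optical_index_def edge_colour_number_def by blast
  have fin: "finite R" using finite_routing[OF R(1) assms(2)] .
  define flip :: "'a \<times> 'a \<Rightarrow> 'a \<times> 'a" where "flip = (\<lambda>(u, v). (v, u))"
  have load: "load R e + load R (flip e) \<le> undirected_optical_index G" for e
  proof -
    let ?S = "\<lambda>e. {p \<in> R. e \<in> set (vwalk_arcs p)}"
    obtain u v where e: "e = (u, v)" by fastforce
    have "distinct p" if "p \<in> R" for p
      using R(1) that by (auto simp: all_to_all_routing_def vpath_def)
    then have "?S e \<inter> ?S (flip e) = {}"
      using distinct_vwalk_arcs_asym by (fastforce simp: e flip_def)
    then have "load R e + load R (flip e) = card (?S e \<union> ?S (flip e))"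
      unfolding load_def using fin by (subst card_Un_disjoint) auto
    also have "\<dots> \<le> card (c ` R)"
    proof (rule card_le_of_conflict[OF fin])
      fix p p' assume p: "p \<in> ?S e \<union> ?S (flip e)" "p' \<in> ?S e \<union> ?S (flip e)" "p \<noteq> p'"
      have "{u, v} \<in> vwalk_edges q" if "q \<in> ?S e \<union> ?S (flip e)" for q
        using that by (force simp: vwalk_edges_def e flip_def)
      then have "vwalk_edges p \<inter> vwalk_edges p' \<noteq> {}" using p by blast
      then show "c p \<noteq> c p'" using R(2) p by (auto simp: edge_conflict_free_def)
    qed auto
    finally show ?thesis by (simp add: R(3))
  qed
  have "(\<Sum>e\<in>parcs G. wt e * load R e) = (\<Sum>e\<in>parcs G. wt e * load R (flip e))"
    by (rule sum.reindex_bij_witness[of _ flip flip])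
      (use sym wt(2) in \<open>auto simp: flip_def split: prod.splits\<close>)
  then have "2 * (\<Sum>e\<in>parcs G. wt e * load R e) = (\<Sum>e\<in>parcs G. wt e * (load R e + load R (flip e)))"
    by (simp add: distrib_left sum.distrib)
  also have "\<dots> \<le> (\<Sum>e\<in>parcs G. wt e * undirected_optical_index G)"
    by (intro sum_mono mult_left_mono wt(1)) (metis load of_nat_add of_nat_mono)
  finally have "2 * (\<Sum>e\<in>parcs G. wt e * load R e) \<le> undirected_optical_index G * (\<Sum>e\<in>parcs G. wt e)"
    by (simp add: sum_distrib_left mult.commute)
  then show ?thesis
    using R(1) weighted_length_eq_load[OF R(1) fin assms(3), of wt] by (intro exI[of _ R]) simp
qed

section \<open>Arc weights and displacements of walks\<close>

definition step_weight :: "int \<Rightarrow> real \<Rightarrow> real \<Rightarrow> int \<times> int \<Rightarrow> real" where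
  "step_weight n \<alpha> \<beta> = (\<lambda>(u, v). if [u - v = 1] (mod n) \<or> [u - v = -1] (mod n) then \<alpha> else \<beta>)"

lemma step_weight_sym: "step_weight n \<alpha> \<beta> (u, v) = step_weight n \<alpha> \<beta> (v, u)"
proof -
  have "[u - v = d] (mod n) \<longleftrightarrow> [v - u = - d] (mod n)" for d
    using cong_minus_minus_iff[of "u - v" d n] by simp
  from this[of 1] this[of "-1"] show ?thesis by (auto simp: step_weight_def)
qed

text \<open>\<open>i\<close> and \<open>j\<close> are the net numbers of unit and long steps;
  cancellation between opposite steps can only lower the weighted count, by the triangle
  inequality.\<close>

lemma walk_displacement:
  assumes "vwalk p (with_proj (circulant n s))" "0 \<le> \<alpha>" "0 \<le> \<beta>"
  shows "\<exists>i j. [last p - hd p = i + j * s] (mod n) \<and>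
    \<alpha> * \<bar>real_of_int i\<bar> + \<beta> * \<bar>real_of_int j\<bar> \<le> sum_list (map (step_weight n \<alpha> \<beta>) (vwalk_arcs p))"
  using assms(1)
proof (induction p rule: vwalk_induct)
  case (Base u)
  have "[last [u] - hd [u] = 0 + 0 * s] (mod n)" by simp
  then show ?case by (intro exI[of _ 0]) auto
next
  case (Cons u v es)
  then obtain i j where ij: "[last (v # es) - v = i + j * s] (mod n)"
    "\<alpha> * \<bar>real_of_int i\<bar> + \<beta> * \<bar>real_of_int j\<bar> \<le> sum_list (map (step_weight n \<alpha> \<beta>) (vwalk_arcs (v # es)))"
    by auto
  have "(u, v) \<in> parcs (circulant n s)" using Cons.hyps by simp
  then obtain d where d: "d \<in> {1, -1, s, -s}" "[u - v = d] (mod n)" by (auto simp: circulant_def)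
  have step: "\<exists>i' j'. [v - u = i' + j' * s] (mod n) \<and>
      \<alpha> * \<bar>real_of_int i'\<bar> + \<beta> * \<bar>real_of_int j'\<bar> \<le> step_weight n \<alpha> \<beta> (u, v)"
  proof -
    have neg: "[v - u = - d] (mod n)" if "[u - v = d] (mod n)" for d
      using that cong_minus_minus_iff[of "u - v" d n] by simp
    show ?thesis
    proof (cases "[u - v = 1] (mod n) \<or> [u - v = -1] (mod n)")
      case True
      then have "[v - u = -1] (mod n) \<or> [v - u = 1] (mod n)" using neg[of 1] neg[of "-1"] by auto
      then obtain d' where d': "\<bar>d'\<bar> = (1::int)" "[v - u = d'] (mod n)" by (metis abs_1 abs_minus_cancel)
      have "\<bar>real_of_int d'\<bar> = 1" using d'(1) by (simp flip: of_int_abs)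
      with d'(2) have "[v - u = d' + 0 * s] (mod n) \<and>
          \<alpha> * \<bar>real_of_int d'\<bar> + \<beta> * \<bar>real_of_int 0\<bar> \<le> step_weight n \<alpha> \<beta> (u, v)"
        using True by (auto simp: step_weight_def)
      then show ?thesis by blast
    next
      case False
      then have "d = s \<or> d = - s" using d by auto
      then obtain j' where j': "\<bar>j'\<bar> = (1::int)" "[v - u = j' * s] (mod n)"
        using neg[OF d(2)] by (metis abs_1 abs_minus_cancel mult_1 mult_minus1 verit_minus_simplify(4))
      have "\<bar>real_of_int j'\<bar> = 1" using j'(1) by (simp flip: of_int_abs)
      with j'(2) have "[v - u = 0 + j' * s] (mod n) \<and>
          \<alpha> * \<bar>real_of_int 0\<bar> + \<beta> * \<bar>real_of_int j'\<bar> \<le> step_weight n \<alpha> \<beta> (u, v)"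
        using False by (auto simp: step_weight_def)
      then show ?thesis by blast
    qed
  qed
  then obtain i' j' where ij': "[v - u = i' + j' * s] (mod n)"
    "\<alpha> * \<bar>real_of_int i'\<bar> + \<beta> * \<bar>real_of_int j'\<bar> \<le> step_weight n \<alpha> \<beta> (u, v)" by blast
  have "[(last (v # es) - v) + (v - u) = (i + j * s) + (i' + j' * s)] (mod n)"
    using ij(1) ij'(1) by (rule cong_add)
  then have 1: "[last (u # v # es) - hd (u # v # es) = (i + i') + (j + j') * s] (mod n)"
    by (simp add: algebra_simps)
  have "\<alpha> * \<bar>real_of_int (i + i')\<bar> \<le> \<alpha> * (\<bar>real_of_int i\<bar> + \<bar>real_of_int i'\<bar>)"
    "\<beta> * \<bar>real_of_int (j + j')\<bar> \<le> \<beta> * (\<bar>real_of_int j\<bar> + \<bar>real_of_int j'\<bar>)"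
    using assms(2,3) by (auto intro!: mult_left_mono)
  then have "\<alpha> * \<bar>real_of_int (i + i')\<bar> + \<beta> * \<bar>real_of_int (j + j')\<bar>
      \<le> sum_list (map (step_weight n \<alpha> \<beta>) (vwalk_arcs (u # v # es)))"
    using ij(2) ij'(2) by (simp add: algebra_simps)
  then show ?case using 1 by blast
qed

lemma circulant_finite: "finite (pverts (circulant n s))" "finite (parcs (circulant n s))"
proof -
  show "finite (pverts (circulant n s))" by (simp add: circulant_def)
  show "finite (parcs (circulant n s))"
    by (rule finite_subset[of _ "{0..<n} \<times> {0..<n}"]) (auto simp: circulant_def)
qed

lemma card_arcs_with_difference:
  assumes "0 < n"
  shows "card {(i, j). i \<in> {0..<n} \<and> j \<in> {0..<n} \<and> ([i - j = d] (mod n) \<or> [i - j = - d] (mod n))} \<le> 2 * nat n"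
    (is "card ?S \<le> _")
proof -
  have "?S \<subseteq> (\<lambda>i. (i, (i - d) mod n)) ` {0..<n} \<union> (\<lambda>i. (i, (i + d) mod n)) ` {0..<n}"
  proof clarify
    fix i j assume ij: "i \<in> {0..<n}" "j \<in> {0..<n}" "[i - j = d] (mod n) \<or> [i - j = - d] (mod n)"
      "(i, j) \<notin> (\<lambda>i. (i, (i + d) mod n)) ` {0..<n}"
    have j: "j = (i - e) mod n" if "[i - j = e] (mod n)" for e
    proof -
      have "[i - (i - j) = i - e] (mod n)" using cong_refl that by (rule cong_diff)
      then show ?thesis using ij(2) by (simp add: cong_def)
    qed
    then show "(i, j) \<in> (\<lambda>i. (i, (i - d) mod n)) ` {0..<n}" using ij by force
  qed
  then have "card ?S \<le> card ((\<lambda>i. (i, (i - d) mod n)) ` {0..<n} \<union> (\<lambda>i. (i, (i + d) mod n)) ` {0..<n})"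
    by (intro card_mono) auto
  also have "\<dots> \<le> card ((\<lambda>i. (i, (i - d) mod n)) ` {0..<n}) + card ((\<lambda>i. (i, (i + d) mod n)) ` {0..<n})"
    by (rule card_Un_le)
  also have "\<dots> \<le> nat n + nat n"
    using card_image_le[of "{0..<n}" "\<lambda>i. (i, (i - d) mod n)"]
      card_image_le[of "{0..<n}" "\<lambda>i. (i, (i + d) mod n)"] by simp
  finally show ?thesis by simp
qed

lemma sum_step_weight_le:
  assumes "0 < n" "0 \<le> \<alpha>" "0 \<le> \<beta>"
  shows "(\<Sum>e\<in>parcs (circulant n s). step_weight n \<alpha> \<beta> e) \<le> 2 * real_of_int n * (\<alpha> + \<beta>)"
proof -
  define D where "D d = {(i, j). i \<in> {0..<n} \<and> j \<in> {0..<n} \<and>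
    ([i - j = d] (mod n) \<or> [i - j = - d] (mod n))}" for d :: int
  have fin: "finite (D d)" for d
    by (rule finite_subset[of _ "{0..<n} \<times> {0..<n}"]) (auto simp: D_def)
  have card: "real (card (D d)) \<le> 2 * n" for d
    using card_arcs_with_difference[OF assms(1), of d] assms(1) unfolding D_def by linarith
  \<comment> \<open>An arc of both kinds is counted as a unit arc, in line with the first branch of
    \<open>step_weight\<close>; each of the two parts has at most \<open>2 * n\<close> arcs.\<close>
  have arcs: "parcs (circulant n s) \<subseteq> D 1 \<union> (D s - D 1)" by (auto simp: circulant_def D_def)
  have wt: "step_weight n \<alpha> \<beta> e = \<alpha>" if "e \<in> D 1" for e
    using that by (auto simp: step_weight_def D_def)
  have wt': "step_weight n \<alpha> \<beta> e = \<beta>" if "e \<in> D s - D 1" for e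
    using that by (auto simp: step_weight_def D_def split: if_splits)
  have nonneg: "0 \<le> step_weight n \<alpha> \<beta> e" for e using assms by (auto simp: step_weight_def split: prod.splits)
  have "(\<Sum>e\<in>parcs (circulant n s). step_weight n \<alpha> \<beta> e)
      \<le> (\<Sum>e\<in>D 1 \<union> (D s - D 1). step_weight n \<alpha> \<beta> e)"
    using arcs fin nonneg by (intro sum_mono2) auto
  also have "\<dots> = (\<Sum>e\<in>D 1. step_weight n \<alpha> \<beta> e) + (\<Sum>e\<in>D s - D 1. step_weight n \<alpha> \<beta> e)"
    using fin by (intro sum.union_disjoint) auto
  also have "\<dots> = card (D 1) * \<alpha> + card (D s - D 1) * \<beta>" by (simp add: wt wt')
  also have "\<dots> \<le> 2 * n * \<alpha> + 2 * n * \<beta>"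
  proof -
    have "real (card (D s - D 1)) \<le> 2 * n"
      using card[of s] card_mono[OF fin[of s], of "D s - D 1"] by force
    then show ?thesis using card[of 1] assms by (intro add_mono mult_right_mono) auto
  qed
  finally show ?thesis by (simp add: algebra_simps)
qed

text \<open>Common source of both lower bounds: \<open>g x y\<close> is the weight of the route from
  \<open>x\<close> to \<open>y\<close> in an optimal routing, and
  \<open>2 * n * (\<alpha> + \<beta>)\<close> bounds the total arc weight.\<close>

lemma displacement_sum_le_optical_index:
  assumes "1 < s" "2 * s < n" "0 \<le> \<alpha>" "0 \<le> \<beta>"
    and "w \<in> {real (directed_optical_index (circulant n s)),
              real (undirected_optical_index (circulant n s)) / 2}"
  obtains g :: "int \<Rightarrow> int \<Rightarrow> real"
    where "\<And>x y. x \<in> {0..<n} \<Longrightarrow> y \<in> {0..<n} \<Longrightarrow>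
        \<exists>i j. [y - x = i + j * s] (mod n) \<and> \<alpha> * \<bar>real_of_int i\<bar> + \<beta> * \<bar>real_of_int j\<bar> \<le> g x y"
      and "(\<Sum>x\<in>{0..<n}. \<Sum>y\<in>{0..<n}. g x y) \<le> w * (2 * real_of_int n * (\<alpha> + \<beta>))"
proof -
  let ?G = "circulant n s" and ?wt = "step_weight n \<alpha> \<beta>"
  have n: "0 < n" using assms by linarith
  have nonneg: "0 \<le> ?wt e" for e using assms(3,4) by (auto simp: step_weight_def split: prod.splits)
  obtain R\<^sub>0 where R0: "all_to_all_routing ?G R\<^sub>0"
    using circulant_optical_index_le(3)[OF assms(1,2)] by blast
  obtain R where R: "all_to_all_routing ?G R"
    "(\<Sum>p\<in>R. \<Sum>e\<in>set (vwalk_arcs p). ?wt e) \<le> w * (\<Sum>e\<in>parcs ?G. ?wt e)"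
  proof -
    from assms(5) consider "w = real (directed_optical_index ?G)" | "w = real (undirected_optical_index ?G) / 2"
      by blast
    then have "\<exists>R. all_to_all_routing ?G R \<and>
        (\<Sum>p\<in>R. \<Sum>e\<in>set (vwalk_arcs p). ?wt e) \<le> w * (\<Sum>e\<in>parcs ?G. ?wt e)"
    proof cases
      case 1
      show ?thesis unfolding 1 by (rule directed_optical_index_ge_load[OF R0 circulant_finite nonneg])
    next
      case 2
      show ?thesis unfolding 2
        by (rule undirected_optical_index_ge_load[where wt = ?wt, OF R0 circulant_finite nonneg
              step_weight_sym circulant_symmetric])
    qed
    then show ?thesis using that by blast
  qed
  define \<phi> :: "int list \<Rightarrow> int \<times> int" where "\<phi> p = (hd p, last p)" for p
  define Z where "Z = {(x, y). x \<in> {0..<n} \<and> y \<in> {0..<n} \<and> x \<noteq> y}"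
  have bij: "bij_betw \<phi> R Z"
    using routing_bij_betw[OF R(1)] unfolding Z_def \<phi>_def by (simp add: circulant_def)
  define len where "len p = (\<Sum>e\<in>set (vwalk_arcs p). ?wt e)" for p
  define g where "g x y = (if x = y then 0 else len (inv_into R \<phi> (x, y)))" for x y
  have disp: "\<exists>i j. [y - x = i + j * s] (mod n) \<and> \<alpha> * \<bar>real_of_int i\<bar> + \<beta> * \<bar>real_of_int j\<bar> \<le> g x y"
    if xy: "x \<in> {0..<n}" "y \<in> {0..<n}" for x y
  proof (cases "x = y")
    case True
    then show ?thesis by (intro exI[of _ 0]) (auto simp: g_def)
  next
    case False
    define p where "p = inv_into R \<phi> (x, y)"
    have "(x, y) \<in> \<phi> ` R" using bij xy False by (auto simp: bij_betw_def Z_def)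
    then have p: "p \<in> R" "hd p = x" "last p = y"
      using inv_into_into[of "(x, y)" \<phi> R] f_inv_into_f[of "(x, y)" \<phi> R] by (auto simp: p_def \<phi>_def)
    then have walk: "vwalk p (with_proj ?G)" "distinct p"
      using R(1) by (auto simp: all_to_all_routing_def vpath_def)
    then have "len p = sum_list (map ?wt (vwalk_arcs p))"
      unfolding len_def by (metis distinct_vwalk_arcs sum_list_distinct_conv_sum_set)
    then show ?thesis
      using walk_displacement[OF walk(1) assms(3,4)] p False by (auto simp: g_def p_def)
  qed
  have total: "(\<Sum>x\<in>{0..<n}. \<Sum>y\<in>{0..<n}. g x y) \<le> w * (2 * real_of_int n * (\<alpha> + \<beta>))"
  proof -
    have "(\<Sum>x\<in>{0..<n}. \<Sum>y\<in>{0..<n}. g x y) = (\<Sum>(x, y)\<in>{0..<n} \<times> {0..<n}. g x y)"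
      by (rule sum.cartesian_product)
    also have "\<dots> = (\<Sum>(x, y)\<in>Z. g x y)"
      by (rule sum.mono_neutral_right) (auto simp: Z_def g_def)
    also have "\<dots> = (\<Sum>z\<in>Z. len (inv_into R \<phi> z))"
      by (rule sum.cong) (auto simp: Z_def g_def)
    also have "\<dots> = (\<Sum>p\<in>R. len p)"
      by (rule sum.reindex_bij_betw[OF bij_betw_inv_into[OF bij]])
    also have "\<dots> \<le> w * (\<Sum>e\<in>parcs ?G. ?wt e)" using R(2) by (simp add: len_def)
    also have "\<dots> \<le> w * (2 * real_of_int n * (\<alpha> + \<beta>))"
      using sum_step_weight_le[OF n assms(3,4)] assms(5) by (intro mult_left_mono) auto
    finally show ?thesis .
  qed
  show ?thesis using that[OF disp total] .
qed

section \<open>Lower bound from cyclic distances\<close>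

lemma cyclic_distance_le:
  fixes n t u :: int
  assumes "0 < n" "[u = t] (mod n)"
  shows "min (u mod n) (n - u mod n) \<le> \<bar>t\<bar>"
proof -
  have u: "u mod n = t mod n" using assms(2) by (simp add: cong_def)
  show ?thesis
  proof (cases "0 \<le> t")
    case True
    then show ?thesis using zmod_le_nonneg_dividend[of t n] u by auto
  next
    case False
    have "(- t) mod n \<le> - t" using False by (intro zmod_le_nonneg_dividend) simp
    then show ?thesis using u False by (auto simp: zmod_zminus1_eq_if split: if_splits)
  qed
qed

text \<open>Passing from \<open>l\<close> to \<open>l + 2\<close> raises the sum by
  \<open>l + 1\<close>, matching \<open>(l + 2)^2 - l^2 = 4 * (l + 1)\<close>; the parity is
  unchanged.\<close>

lemma sum_cyclic_distance_nat:
  "4 * (\<Sum>d<k. min (int d) (int k - int d)) = (int k)\<^sup>2 - (if odd k then 1 else 0)"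
proof (induction k rule: less_induct)
  case (less k)
  consider "k = 0" | "k = 1" | l where "k = Suc (Suc l)" by (metis One_nat_def not0_implies_Suc)
  then show ?case
  proof cases
    case 3
    have "(\<Sum>d<k. min (int d) (int k - int d)) = (\<Sum>d<Suc l. min (int d + 1) (int l + 1 - int d))"
      unfolding 3 by (subst sum.lessThan_Suc_shift) (auto intro!: sum.cong simp: algebra_simps)
    also have "\<dots> = (\<Sum>d<Suc l. min (int d) (int l - int d) + 1)"
      by (intro sum.cong) auto
    also have "\<dots> = (\<Sum>d<l. min (int d) (int l - int d)) + int l + 1"
      by (simp add: sum.distrib)
    finally show ?thesis using less.IH[of l] by (simp add: 3 power2_eq_square algebra_simps)
  qed auto
qed

lemma sum_cyclic_distance:
  fixes n x :: int
  assumes "0 < n"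
  shows "4 * (\<Sum>y = 0..<n. min ((y - x) mod n) (n - (y - x) mod n)) = n\<^sup>2 - (if odd n then 1 else 0)"
proof -
  have "(\<Sum>y = 0..<n. min ((y - x) mod n) (n - (y - x) mod n)) = (\<Sum>d = 0..<n. min d (n - d))"
  proof (rule sum.reindex_bij_witness[of _ "\<lambda>d. (d + x) mod n" "\<lambda>y. (y - x) mod n"])
    show "((y - x) mod n + x) mod n = y" "((y + x) mod n - x) mod n = y" if "y \<in> {0..<n}" for y
      using that by (simp_all add: mod_add_left_eq mod_diff_left_eq)
  qed (use assms in auto)
  also have "\<dots> = (\<Sum>d<nat n. min (int d) (int (nat n) - int d))"
    by (rule sum.reindex_bij_witness[of _ int nat]) auto
  finally show ?thesis using sum_cyclic_distance_nat[of "nat n"] assms by (auto simp: even_nat_iff)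
qed

text \<open>With weights 1 and \<open>s\<close> each of the \<open>n\<close> rows of
  \<open>g\<close> sums to at least \<open>(n^2 - odd_ind n) / 4\<close>, against a total capacity
  of \<open>2 * n * (1 + s) * w\<close>.\<close>

lemma optical_index_ge_cyclic:
  fixes n s :: int
  assumes "1 < s" "2 * s < n"
    and "w \<in> {real (directed_optical_index (circulant n s)),
              real (undirected_optical_index (circulant n s)) / 2}"
  shows "(n\<^sup>2 - odd_ind n) / (8 * (s + 1)) \<le> w"
proof -
  have n: "0 < n" and s: "0 \<le> real_of_int s" using assms by linarith+
  obtain g :: "int \<Rightarrow> int \<Rightarrow> real"
    where g: "\<And>x y. x \<in> {0..<n} \<Longrightarrow> y \<in> {0..<n} \<Longrightarrow>
        \<exists>i j. [y - x = i + j * s] (mod n) \<and> 1 * \<bar>real_of_int i\<bar> + s * \<bar>real_of_int j\<bar> \<le> g x y"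
      and total: "(\<Sum>x\<in>{0..<n}. \<Sum>y\<in>{0..<n}. g x y) \<le> w * (2 * real_of_int n * (1 + real_of_int s))"
    using displacement_sum_le_optical_index[OF assms(1,2) zero_le_one s assms(3)] by blast
  have row: "(n\<^sup>2 - odd_ind n) / 4 \<le> (\<Sum>y\<in>{0..<n}. g x y)" if x: "x \<in> {0..<n}" for x
  proof -
    have "real_of_int (min ((y - x) mod n) (n - (y - x) mod n)) \<le> g x y" if y: "y \<in> {0..<n}" for y
    proof -
      obtain i j where ij: "[y - x = i + j * s] (mod n)" "\<bar>real_of_int i\<bar> + s * \<bar>real_of_int j\<bar> \<le> g x y"
        using g[OF x y] by auto
      have "real_of_int (min ((y - x) mod n) (n - (y - x) mod n)) \<le> real_of_int \<bar>i + j * s\<bar>"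
        using cyclic_distance_le[OF n ij(1)] by (simp only: of_int_le_iff)
      also have "\<dots> \<le> \<bar>real_of_int i\<bar> + s * \<bar>real_of_int j\<bar>"
        using abs_triangle_ineq[of "real_of_int i" "real_of_int j * s"] s by (simp add: abs_mult mult.commute)
      finally show ?thesis using ij(2) by simp
    qed
    then have "(\<Sum>y = 0..<n. real_of_int (min ((y - x) mod n) (n - (y - x) mod n))) \<le> (\<Sum>y\<in>{0..<n}. g x y)"
      by (rule sum_mono)
    moreover have "4 * (\<Sum>y = 0..<n. real_of_int (min ((y - x) mod n) (n - (y - x) mod n))) = n\<^sup>2 - odd_ind n"
      using arg_cong[OF sum_cyclic_distance[OF n, of x], of real_of_int] by (simp add: odd_ind_def)
    ultimately show ?thesis by simp
  qed
  have "n * ((n\<^sup>2 - odd_ind n) / 4) = (\<Sum>x\<in>{0..<n}. (n\<^sup>2 - odd_ind n) / 4)" using n by simp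
  also have "\<dots> \<le> (\<Sum>x\<in>{0..<n}. \<Sum>y\<in>{0..<n}. g x y)" by (intro sum_mono row)
  also have "\<dots> \<le> n * (w * (2 * (1 + s)))" using total by (simp add: algebra_simps)
  finally have "(n\<^sup>2 - odd_ind n) / 4 \<le> w * (2 * (1 + s))" using n by (simp only: mult_le_cancel_left_pos of_int_0_less_iff)
  then show ?thesis using s by (simp add: divide_le_eq algebra_simps)
qed

section \<open>Lower bound from the size of balls\<close>

lemma card_int_diamond_le:
  "card {(i, j :: int). \<bar>i\<bar> + \<bar>j\<bar> \<le> int r} \<le> 2 * r\<^sup>2 + 2 * r + 1"
proof -
  have width: "(\<Sum>i = - int r..int r. 2 * (int r - \<bar>i\<bar>) + 1) = 2 * (int r)\<^sup>2 + 2 * int r + 1" for r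
  proof (induction r)
    case (Suc r)
    have set: "{- int (Suc r)..int (Suc r)} = insert (- int r - 1) (insert (int r + 1) {- int r..int r})"
      by auto
    have "(\<Sum>i = - int r..int r. 2 * (int (Suc r) - \<bar>i\<bar>) + 1) =
        (\<Sum>i = - int r..int r. (2 * (int r - \<bar>i\<bar>) + 1) + 2)"
      by (intro sum.cong) auto
    \<comment> \<open>Enlarging the radius widens each of the \<open>2 * r + 1\<close> columns by 2;
      the two new outer columns have one point each.\<close>
    then have "(\<Sum>i = - int r..int r. 2 * (int (Suc r) - \<bar>i\<bar>) + 1) =
        (\<Sum>i = - int r..int r. 2 * (int r - \<bar>i\<bar>) + 1) + 2 * (2 * int r + 1)"
      by (simp add: sum.distrib)
    then show ?case using Suc.IH unfolding set by (simp add: power2_eq_square algebra_simps)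
  qed simp
  have "{(i, j :: int). \<bar>i\<bar> + \<bar>j\<bar> \<le> int r} = (SIGMA i:{- int r..int r}. {- (int r - \<bar>i\<bar>)..int r - \<bar>i\<bar>})"
    by auto
  then have "int (card {(i, j :: int). \<bar>i\<bar> + \<bar>j\<bar> \<le> int r}) =
      (\<Sum>i = - int r..int r. int (nat (2 * (int r - \<bar>i\<bar>) + 1)))"
    by (simp add: card_SigmaI algebra_simps)
  also have "\<dots> = (\<Sum>i = - int r..int r. 2 * (int r - \<bar>i\<bar>) + 1)"
    by (intro sum.cong) auto
  finally have "int (card {(i, j :: int). \<bar>i\<bar> + \<bar>j\<bar> \<le> int r}) = int (2 * r\<^sup>2 + 2 * r + 1)"
    unfolding width by simp
  then show ?thesis by (simp only: of_nat_eq_iff order_refl)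
qed

lemma finite_int_diamond: "finite {(i, j :: int). \<bar>i\<bar> + \<bar>j\<bar> \<le> int r}"
  by (rule finite_subset[of _ "{- int r..int r} \<times> {- int r..int r}"]) auto

text \<open>The sum counts positive integers up to \<open>x\<close>. It bounds a path weight below
  by the number of radii it exceeds, without the weight being an integer.\<close>

lemma sum_of_bool_Suc_le:
  fixes x :: real
  assumes "0 \<le> x"
  shows "(\<Sum>r<m. of_bool (real r + 1 \<le> x)) \<le> x"
proof -
  have "(\<Sum>r<m. of_bool (real r + 1 \<le> x)) = real (card {r. r < m \<and> real r + 1 \<le> x})"
    by (simp add: sum.If_cases of_bool_def Int_def conj_commute lessThan_def)
  also have "\<dots> \<le> real (card {..<nat \<lfloor>x\<rfloor>})"
  proof -
    have "{r. r < m \<and> real r + 1 \<le> x} \<subseteq> {..<nat \<lfloor>x\<rfloor>}"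
    proof
      fix r assume "r \<in> {r. r < m \<and> real r + 1 \<le> x}"
      then have "int r + 1 \<le> \<lfloor>x\<rfloor>" by (simp add: le_floor_iff)
      then show "r \<in> {..<nat \<lfloor>x\<rfloor>}" by auto
    qed
    then show ?thesis by (intro of_nat_mono card_mono) auto
  qed
  also have "\<dots> \<le> x" using assms by simp
  finally show ?thesis .
qed

text \<open>Layer-cake summation over radii \<open>r < m\<close>: with unit weights, fewer than
  \<open>r + 1\<close> steps reach only points given by a diamond of radius \<open>r\<close>, so all
  other vertices contribute to layer \<open>r\<close>. The cutoff \<open>m\<close> is left free for
  later optimisation.\<close>

lemma optical_index_ge_ball:
  fixes n s :: int
  assumes "1 < s" "2 * s < n"
    and "w \<in> {real (directed_optical_index (circulant n s)),
              real (undirected_optical_index (circulant n s)) / 2}"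
  shows "real m * (n - 1) - 2 * (real m ^ 3 - real m) / 3 \<le> 4 * w"
proof -
  have n: "0 < n" using assms by linarith
  obtain g :: "int \<Rightarrow> int \<Rightarrow> real"
    where g: "\<And>x y. x \<in> {0..<n} \<Longrightarrow> y \<in> {0..<n} \<Longrightarrow>
        \<exists>i j. [y - x = i + j * s] (mod n) \<and> 1 * \<bar>real_of_int i\<bar> + 1 * \<bar>real_of_int j\<bar> \<le> g x y"
      and total: "(\<Sum>x\<in>{0..<n}. \<Sum>y\<in>{0..<n}. g x y) \<le> w * (2 * real_of_int n * (1 + 1))"
    using displacement_sum_le_optical_index[OF assms(1,2) zero_le_one zero_le_one assms(3)] by blast
  have far: "n - (2 * (real r)\<^sup>2 + 2 * real r + 1) \<le> (\<Sum>y\<in>{0..<n}. of_bool (real r + 1 \<le> g x y))"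
    if x: "x \<in> {0..<n}" for x r
  proof -
    define N where "N = {y \<in> {0..<n}. \<not> real r + 1 \<le> g x y}"
    have "N \<subseteq> (\<lambda>(i, j). (x + (i + j * s)) mod n) ` {(i, j). \<bar>i\<bar> + \<bar>j\<bar> \<le> int r}"
    proof
      fix y assume y: "y \<in> N"
      then obtain i j where ij: "[y - x = i + j * s] (mod n)" "\<bar>real_of_int i\<bar> + \<bar>real_of_int j\<bar> \<le> g x y"
        using g[OF x, of y] by (auto simp: N_def)
      then have "\<bar>i\<bar> + \<bar>j\<bar> \<le> int r" using y by (auto simp: N_def)
      moreover have "[x + (y - x) = x + (i + j * s)] (mod n)" using cong_refl ij(1) by (rule cong_add)
      then have "y = (x + (i + j * s)) mod n" using y by (simp add: cong_def N_def)
      ultimately show "y \<in> (\<lambda>(i, j). (x + (i + j * s)) mod n) ` {(i, j). \<bar>i\<bar> + \<bar>j\<bar> \<le> int r}" by force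
    qed
    then have "card N \<le> card {(i, j :: int). \<bar>i\<bar> + \<bar>j\<bar> \<le> int r}"
      by (rule surj_card_le[OF finite_int_diamond])
    also have "\<dots> \<le> 2 * r\<^sup>2 + 2 * r + 1" by (rule card_int_diamond_le)
    finally have "real (card N) \<le> real (2 * r\<^sup>2 + 2 * r + 1)" by (rule of_nat_mono)
    moreover have "(\<Sum>y\<in>{0..<n}. of_bool (real r + 1 \<le> g x y)) = real_of_int n - real (card N)"
    proof -
      have "(\<Sum>y\<in>{0..<n}. of_bool (real r + 1 \<le> g x y)) = (\<Sum>y\<in>{0..<n}. 1 - of_bool (y \<in> N) :: real)"
        by (intro sum.cong) (auto simp: N_def)
      also have "\<dots> = real_of_int n - (\<Sum>y\<in>{0..<n}. of_bool (y \<in> N))" using n by (simp add: sum_subtractf)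
      also have "(\<Sum>y\<in>{0..<n}. of_bool (y \<in> N)) = real (card N)"
        by (simp add: N_def Int_def)
      finally show ?thesis .
    qed
    ultimately show ?thesis by simp
  qed
  have row: "(\<Sum>r<m. n - (2 * (real r)\<^sup>2 + 2 * real r + 1)) \<le> (\<Sum>y\<in>{0..<n}. g x y)"
    if x: "x \<in> {0..<n}" for x
  proof -
    have "(\<Sum>r<m. n - (2 * (real r)\<^sup>2 + 2 * real r + 1)) \<le>
        (\<Sum>r<m. \<Sum>y\<in>{0..<n}. of_bool (real r + 1 \<le> g x y))"
      by (intro sum_mono far x)
    also have "\<dots> = (\<Sum>y\<in>{0..<n}. \<Sum>r<m. of_bool (real r + 1 \<le> g x y))" by (rule sum.swap)
    also have "\<dots> \<le> (\<Sum>y\<in>{0..<n}. g x y)"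
      using g[OF x] by (intro sum_mono sum_of_bool_Suc_le) force
    finally show ?thesis .
  qed
  have "(\<Sum>r<m. n - (2 * (real r)\<^sup>2 + 2 * real r + 1)) = real m * (n - 1) - 2 * (real m ^ 3 - real m) / 3"
    by (induction m) (auto simp: field_simps power2_eq_square power3_eq_cube)
  then have "n * (real m * (n - 1) - 2 * (real m ^ 3 - real m) / 3) =
      (\<Sum>x\<in>{0..<n}. \<Sum>r<m. n - (2 * (real r)\<^sup>2 + 2 * real r + 1))"
    using n by simp
  also have "\<dots> \<le> (\<Sum>x\<in>{0..<n}. \<Sum>y\<in>{0..<n}. g x y)" by (intro sum_mono row)
  also have "\<dots> \<le> n * (4 * w)" using total by (simp add: algebra_simps)
  finally show ?thesis using n by (simp only: mult_le_cancel_left_pos of_int_0_less_iff)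
qed

lemma optical_index_ge_cubic:
  fixes n s :: int
  assumes "1 < s" "2 * s < n"
    and "w \<in> {real (directed_optical_index (circulant n s)),
              real (undirected_optical_index (circulant n s)) / 2}"
  shows "(n - 1) * (sqrt (2 * n) - 7) ^ 3 / (24 * n) \<le> w"
proof -
  have n: "0 < real_of_int n" "1 \<le> real_of_int n" using assms by linarith+
  define t where "t = sqrt (2 * n)"
  have t: "0 \<le> t" "t\<^sup>2 = 2 * n" using n by (auto simp: t_def)
  have w: "0 \<le> w" using assms(3) by auto
  show ?thesis
  proof (cases "t < 7")
    case True
    then have "(n - 1) * (t - 7) ^ 3 \<le> 0"
      using n by (intro mult_nonneg_nonpos) (auto simp: power_le_zero_eq)
    then have "(n - 1) * (t - 7) ^ 3 / (24 * n) \<le> 0" using n by (simp add: divide_nonpos_pos)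
    then show ?thesis using w by (simp add: t_def)
  next
    case False
    \<comment> \<open>A ball of radius \<open>r\<close> has about \<open>2 * r^2\<close> points and
      exhausts the \<open>n\<close> vertices near \<open>r = sqrt (n / 2) = t / 2\<close>, so later
      layers would add nothing.\<close>
    define m where "m = nat \<lfloor>t / 2\<rfloor>"
    have m: "t / 2 - 1 \<le> real m" "real m \<le> t / 2" "0 \<le> real m" using t(1) by (auto simp: m_def) linarith+
    have n_eq: "real_of_int (n - 1) = t\<^sup>2 / 2 - 1" using t by simp
    have "(t / 2 - 1) * (t\<^sup>2 / 3 - 1) \<le> real m * (t\<^sup>2 / 3 - 1)"
    proof (rule mult_right_mono[OF m(1)])
      have "7\<^sup>2 \<le> t\<^sup>2" using False by (intro power_mono) auto
      then show "0 \<le> t\<^sup>2 / 3 - 1" by simp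
    qed
    also have "\<dots> \<le> real m * (n - 1) - 2 * (real m ^ 3 - real m) / 3"
    proof -
      \<comment> \<open>Replacing one factor \<open>m^2\<close> by \<open>t^2 / 4\<close> leaves
        \<open>m\<close> times \<open>t^2 / 2 - 1 - t^2 / 6 + 2 / 3\<close>, which is at least
        \<open>m * (t^2 / 3 - 1)\<close>.\<close>
      have "real m * (real m)\<^sup>2 \<le> real m * (t / 2)\<^sup>2" using m by (intro mult_left_mono power_mono) auto
      then show ?thesis using m(3) unfolding n_eq
        by (simp add: power3_eq_cube power2_eq_square field_simps)
    qed
    also have "\<dots> \<le> 4 * w" by (rule optical_index_ge_ball[OF assms])
    finally have low: "(t / 2 - 1) * (t\<^sup>2 / 3 - 1) \<le> 4 * w" .
    have "(t - 7) ^ 3 \<le> 6 * ((t / 2 - 1) * (t\<^sup>2 / 3 - 1))"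
    proof -
      \<comment> \<open>The cubic terms cancel and leave \<open>19 * t^2 - 150 * t + 349\<close>;
        the right side completes the square.\<close>
      have "6 * ((t / 2 - 1) * (t\<^sup>2 / 3 - 1)) - (t - 7) ^ 3 = 19 * (t - 75 / 19)\<^sup>2 + 1006 / 19"
        by (simp add: power3_eq_cube power2_eq_square field_simps)
      also have "\<dots> \<ge> 0" by simp
      finally show ?thesis by simp
    qed
    then have cube: "(t - 7) ^ 3 \<le> 24 * w" using low by simp
    have "(n - 1) * (t - 7) ^ 3 \<le> n * (t - 7) ^ 3"
      using False by (intro mult_right_mono) auto
    also have "\<dots> \<le> n * (24 * w)" using cube n by (intro mult_left_mono) auto
    finally show ?thesis using n by (simp add: t_def divide_le_eq algebra_simps)
  qed
qed

section \<open>Linearising the square-root conditions\<close>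

lemma le_sqrt_threshold:
  fixes s q k :: real
  assumes "0 < s" "0 \<le> q" "s \<le> sqrt (q * s + k\<^sup>2) + k"
  shows "s \<le> q + 2 * k"
proof (cases "s \<le> k")
  case True
  then show ?thesis using assms by linarith
next
  case False
  \<comment> \<open>Squaring is legitimate as \<open>k < s\<close>; then \<open>k^2\<close> cancels
    and a factor \<open>s\<close> divides out, because \<open>n - r = q * s\<close> is a multiple of
    \<open>s\<close>.\<close>
  then have "(s - k)\<^sup>2 \<le> (sqrt (q * s + k\<^sup>2))\<^sup>2" using assms(3) by (intro power_mono) auto
  also have "\<dots> = q * s + k\<^sup>2" using assms by simp
  finally have "s * s \<le> s * (q + 2 * k)" by (simp add: power2_eq_square algebra_simps)
  then show ?thesis using assms(1) by simp
qed

lemma sqrt_threshold_le: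
  fixes s q k :: real
  assumes "0 < s" "0 \<le> q" "sqrt (q * s + k\<^sup>2) + k \<le> s"
  shows "q + 2 * k \<le> s"
proof -
  have "q * s + k\<^sup>2 = (sqrt (q * s + k\<^sup>2))\<^sup>2" using assms by simp
  also have "\<dots> \<le> (s - k)\<^sup>2" using assms by (intro power_mono) auto
  finally have "s * (q + 2 * k) \<le> s * s" by (simp add: power2_eq_square algebra_simps)
  then show ?thesis using assms(1) by simp
qed

theorem theorem1p4:
  fixes n s q r :: int
  assumes "n \<ge> 5"
    and "1 < s" and "real_of_int s < real_of_int n / 2"
    and "q = \<lfloor>real_of_int n / real_of_int s\<rfloor>"
    and "r = n - q * s"
  shows "\<forall>w \<in> {real (directed_optical_index (circulant n s)),
               real (undirected_optical_index (circulant n s)) / 2}.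
    (2 \<le> s \<and> real_of_int s \<le> sqrt (n - r + (kappa s q (-2))^2) + kappa s q (-2) \<longrightarrow>
       (n^2 - odd_ind n) / (8 * (s + 1)) \<le> w \<and>
       w \<le> (s + 2) / 24 *
            (6 * q^2 + 3 * q * (s + 4) + s * (4 * s + 10) + odd_ind q * (2 * q + 3 * s + 3))) \<and>
    (sqrt (n - r + (kappa s q (-1))^2) + kappa s q (-1) \<le> real_of_int s \<and>
     real_of_int s \<le> sqrt (n - r + (kappa s q 0)^2) + kappa s q 0 \<longrightarrow>
       (n^2 - odd_ind n) / (8 * (s + 1)) \<le> w \<and>
       w \<le> q * (q + 2) * (5 * q + 2) / 24 + s * (s + 2) * (2 * s + 5) / 6
            + odd_ind q * ((5 * q^2 + 13 * q + 7) / 8)) \<and>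
    (sqrt (n - r + (kappa s q 1)^2) + kappa s q 1 \<le> real_of_int s \<and>
     real_of_int s < real_of_int n / 2 \<longrightarrow>
       max ((n^2 - odd_ind n) / (8 * (s + 1)))
           ((n - 1) * (sqrt (2 * n) - 7)^3 / (24 * n)) \<le> w \<and>
       w \<le> q * (q + 2) * (q + 10) / 24 + s * (s + 2) * (q + 1) / 2
            + odd_ind q * (((q + 5)^2 + 4 * (s + 1)^2) / 8))"
proof -
  have s2n: "2 * s < n" using assms(3) by linarith
  have q_div: "q = n div s" using assms(4) by (simp add: floor_divide_of_int_eq)
  have qs: "q * s \<le> n" "n < (q + 1) * s" "2 \<le> q"
  proof -
    have "n = q * s + n mod s" "0 \<le> n mod s" "n mod s < s" using assms(2) by (auto simp: q_div)
    then show *: "q * s \<le> n" "n < (q + 1) * s" by (auto simp: algebra_simps)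
    have "2 * s < (q + 1) * s" using * s2n by linarith
    from mult_right_less_imp_less[OF this] show "2 \<le> q" using assms(2) by simp
  qed
  \<comment> \<open>\<open>B\<close> rounds \<open>q / 2\<close> up, since negative remainders
    occupy the extra top row for odd \<open>q\<close>.\<close>
  define e f A B where "e = q mod 2" and "f = s mod 2" and "A = s div 2" and "B = (q + 1) div 2"
  have ef: "e \<in> {0, 1}" "f \<in> {0, 1}" by (auto simp: e_def f_def)
  have q_eq: "q = 2 * B - e" and s_eq: "s = 2 * A + f" unfolding e_def B_def f_def A_def by presburger+
  have halves: "q div 2 = B - e" "(s - 1) div 2 = A - 1 + f" unfolding e_def B_def f_def A_def by presburger+
  have odd_q: "odd_ind q = e" and odd_s: "odd_ind s = f"
    by (auto simp: odd_ind_def e_def f_def odd_iff_mod_2_eq_one)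
  have A: "1 \<le> A" and B: "1 + e \<le> B" using q_eq s_eq ef assms(2) qs(3) by auto
  \<comment> \<open>Doubling turns the half parities inside \<open>kappa\<close> into the integers
    \<open>f\<close> and \<open>e\<close>, so every threshold becomes an integer inequality between
    \<open>s\<close> and \<open>q\<close>.\<close>
  have kappa: "2 * kappa s q a = 2 * a + f + e" for a by (simp add: kappa_def odd_q odd_s)
  have nr: "real_of_int n - real_of_int r = real_of_int q * real_of_int s" using assms(5) by simp
  define K where "K = (\<Sum>d = 1..n div 2. class_cost s d)"
  have K: "24 * int K \<le> 24 * (2 * A * (A + 1) + (B - e) * (B - e + 1) + block_cost A (B - e) + block_cost (A - 1 + f) B)"
    using sum_class_cost_le[OF assms(2) qs] unfolding K_def halves A_def[symmetric] B_def[symmetric] by simp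
  show ?thesis
  proof
    fix w
    assume w: "w \<in> {real (directed_optical_index (circulant n s)),
                    real (undirected_optical_index (circulant n s)) / 2}"
    have wK: "w \<le> real K"
      using w circulant_optical_index_le(1,2)[OF assms(2) s2n] unfolding K_def[symmetric] by auto
    have upper: "24 * w \<le> real_of_int Z"
      if "24 * (2 * A * (A + 1) + (B - e) * (B - e + 1) + block_cost A (B - e) + block_cost (A - 1 + f) B) \<le> Z"
      for Z
    proof -
      have "real_of_int (24 * int K) \<le> real_of_int Z" using K that by (simp only: of_int_le_iff)
      then show ?thesis using wK by simp
    qed
    note lower = optical_index_ge_cyclic[OF assms(2) s2n w] optical_index_ge_cubic[OF assms(2) s2n w]
    note below = le_sqrt_threshold[of "real_of_int s" "real_of_int q"]
      and above = sqrt_threshold_le[of "real_of_int s" "real_of_int q"]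
    have pos: "0 < real_of_int s" "0 \<le> real_of_int q" using assms(2) qs(3) by auto
    have a: "w \<le> (s + 2) / 24 *
            (6 * q^2 + 3 * q * (s + 4) + s * (4 * s + 10) + odd_ind q * (2 * q + 3 * s + 3))"
      if "real_of_int s \<le> sqrt (n - r + (kappa s q (-2))^2) + kappa s q (-2)"
    proof -
      have "real_of_int s \<le> q + 2 * kappa s q (-2)" using below[OF pos] that nr by simp
      then have "s \<le> q - 4 + f + e" unfolding kappa by linarith
      \<comment> \<open>With \<open>q = 2 * B - e\<close> and \<open>s = 2 * A + f\<close> the
        parities cancel and the factor 2 divides out, so the three cases become
        \<open>A + 2 \<le> B\<close>, \<open>B \<in> {A, A + 1}\<close> and
        \<open>B + 1 \<le> A\<close>.\<close>
      then have "A + 2 \<le> B" using q_eq s_eq by linarith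
      from upper[OF cost_le_many_rows[OF ef A this q_eq s_eq]] show ?thesis
        unfolding odd_q by (simp add: field_simps)
    qed
    have b: "w \<le> q * (q + 2) * (5 * q + 2) / 24 + s * (s + 2) * (2 * s + 5) / 6
            + odd_ind q * ((5 * q^2 + 13 * q + 7) / 8)"
      if "sqrt (n - r + (kappa s q (-1))^2) + kappa s q (-1) \<le> real_of_int s"
        "real_of_int s \<le> sqrt (n - r + (kappa s q 0)^2) + kappa s q 0"
    proof -
      have "real_of_int s \<le> q + 2 * kappa s q 0" using below[OF pos] that nr by simp
      then have 1: "s \<le> q + f + e" unfolding kappa by linarith
      have "q + 2 * kappa s q (-1) \<le> real_of_int s" using above[OF pos] that nr by simp
      then have "q - 2 + f + e \<le> s" unfolding kappa by linarith
      then have "B = A \<or> B = A + 1" using 1 q_eq s_eq by linarith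
      from upper[OF cost_le_balanced[OF ef A B this q_eq s_eq]] show ?thesis
        unfolding odd_q by (simp add: field_simps)
    qed
    have c: "w \<le> q * (q + 2) * (q + 10) / 24 + s * (s + 2) * (q + 1) / 2
            + odd_ind q * (((q + 5)^2 + 4 * (s + 1)^2) / 8)"
      if "sqrt (n - r + (kappa s q 1)^2) + kappa s q 1 \<le> real_of_int s"
    proof -
      have "q + 2 * kappa s q 1 \<le> real_of_int s" using above[OF pos] that nr by simp
      then have "q + 2 + f + e \<le> s" unfolding kappa by linarith
      then have "B + 1 \<le> A" using q_eq s_eq by linarith
      from upper[OF cost_le_few_rows[OF ef B this q_eq s_eq]] show ?thesis
        unfolding odd_q by (simp add: field_simps)
    qed
    show "(2 \<le> s \<and> real_of_int s \<le> sqrt (n - r + (kappa s q (-2))^2) + kappa s q (-2) \<longrightarrow>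
       (n^2 - odd_ind n) / (8 * (s + 1)) \<le> w \<and>
       w \<le> (s + 2) / 24 *
            (6 * q^2 + 3 * q * (s + 4) + s * (4 * s + 10) + odd_ind q * (2 * q + 3 * s + 3))) \<and>
    (sqrt (n - r + (kappa s q (-1))^2) + kappa s q (-1) \<le> real_of_int s \<and>
     real_of_int s \<le> sqrt (n - r + (kappa s q 0)^2) + kappa s q 0 \<longrightarrow>
       (n^2 - odd_ind n) / (8 * (s + 1)) \<le> w \<and>
       w \<le> q * (q + 2) * (5 * q + 2) / 24 + s * (s + 2) * (2 * s + 5) / 6
            + odd_ind q * ((5 * q^2 + 13 * q + 7) / 8)) \<and>
    (sqrt (n - r + (kappa s q 1)^2) + kappa s q 1 \<le> real_of_int s \<and>
     real_of_int s < real_of_int n / 2 \<longrightarrow>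
       max ((n^2 - odd_ind n) / (8 * (s + 1)))
           ((n - 1) * (sqrt (2 * n) - 7)^3 / (24 * n)) \<le> w \<and>
       w \<le> q * (q + 2) * (q + 10) / 24 + s * (s + 2) * (q + 1) / 2
            + odd_ind q * (((q + 5)^2 + 4 * (s + 1)^2) / 8))"
      using lower a b c by (intro conjI impI max.boundedI) blast+
  qed
qed

end
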